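(* Let $\mathbf A=\langle A,\land^A,\lor^A,\supset^A,\neg^A,\top^A\rangle$ be a residuated De Morgan lattice and let $\mathbf A^-=\langle A^-,\land^A,\lor^A\rangle$ be the sublattice of $\mathbf A$ with universe $A^-=\{a\in A: a\leq\top^A\}$. Then: (i) $\mathbf A^-$ is dually isomorphic to $\mathbf A^+=\langle A^+,\land^A,\lor^A\rangle$, the sublattice of $\mathbf A$ with universe $A^+=\{a\in A: a\geq\top^A\}$. (ii) $\mathbf A^-$ and $\mathbf A^+$ are relatively complemented. (iii) There is an embedding $h:A\to A^-\times A^-$ of $\mathbf A$ into the implicative bilattice $\mathbf B=\langle\mathbf A^-\odot\mathbf A^-,\supset^B\rangle$ (or into $\langle\mathbf A^+\odot\mathbf A^+,\supset\rangle$). (iv) If $f:A\to B_1$ is a homomorphism from $\mathbf A$ to an implicative bilattice $\mathbf B_1$, then there is a unique map $f':A^-\times A^-\to B_1$ which is also a homomorphism of $\mathbf B=\langle\mathbf A^-\odot\mathbf A^-,\supset^B\rangle$ into $\mathbf B_1$ such that $f'\cdot h=f$. Moreover, if $f$ is injective, so is $f'$.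
   Context: A residuated De Morgan lattice is an algebra $\langle A,\land,\lor,\supset,\neg,\top\rangle$ such that $\langle A,\land,\lor,\neg\rangle$ is a De Morgan lattice (distributive lattice, not necessarily bounded, with an involutive order-reversing $\neg$) and: (RD0) $\top\approx\neg\top$; (RD1) $\top\supset x\approx x$; (RD2) $x\supset(y\supset z)\approx(x\land y)\supset z$; (RD3) $\top\land(((x\supset y)\supset x)\supset x)\approx\top$; (RD4) $(x\lor y)\supset z\approx(x\supset z)\land(y\supset z)$; (RD5) $x\land(((x\supset y)\land(\neg y\supset\neg x))\supset y)\approx x$; (RD6) $\neg(x\supset y)\supset z\approx(x\land\neg y)\supset z$. A bilattice is an algebra $\langle B,\land,\lor,\otimes,\oplus,\neg\rangle$ such that $\langle B,\land,\lor\rangle$ and $\langle B,\otimes,\oplus\rangle$ are lattices (not necessarily bounded) with orders $\leq_t$ and $\leq_k$, and $\neg$ is unary with: $a\leq_t b\Rightarrow\neg b\leq_t\neg a$; $a\leq_k b\Rightarrow\neg a\leq_k\neg b$; $\neg\neg a=a$. An implicative bilattice is an algebra $\langle B,\land,\lor,\otimes,\oplus,\supset,\neg\rangle$ whose $\supset$-free reduct is a bilattice and which satisfies: (IB1) $(x\supset x)\supset y\approx y$; (IB2) $x\supset(y\supset z)\approx(x\land y)\supset z\approx(x\otimes y)\supset z$; (IB3) $((x\supset y)\supset x)\supset x\approx x\supset x$; (IB4) $(x\lor y)\supset z\approx(x\supset z)\land(y\supset z)\approx(x\oplus y)\supset z$; (IB5) $x\land((x\supset y)\supset(x\otimes y))\approx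 x$; (IB6) $\neg(x\supset y)\supset z\approx(x\land\neg y)\supset z$. In an implicative bilattice the term $(x\supset x)\oplus\neg(x\supset x)$ is constant and its value $\top$ is the $\leq_k$-maximum. For a relatively complemented distributive lattice $\mathbf L=\langle L,\sqcap,\sqcup\rangle$ with maximum $1$, let $a\backslash b$ be the relative complement of $a$ in $[a\sqcap b,1]$. $\langle\mathbf L\odot\mathbf L,\supset\rangle$ is the implicative bilattice with universe $L\times L$ and operations $\langle a_1,a_2\rangle\land\langle b_1,b_2\rangle=\langle a_1\sqcap b_1,a_2\sqcup b_2\rangle$, $\langle a_1,a_2\rangle\lor\langle b_1,b_2\rangle=\langle a_1\sqcup b_1,a_2\sqcap b_2\rangle$, $\langle a_1,a_2\rangle\otimes\langle b_1,b_2\rangle=\langle a_1\sqcap b_1,a_2\sqcap b_2\rangle$, $\langle a_1,a_2\rangle\oplus\langle b_1,b_2\rangle=\langle a_1\sqcup b_1,a_2\sqcup b_2\rangle$, $\neg\langle a_1,a_2\rangle=\langle a_2,a_1\rangle$, $\langle a_1,a_2\rangle\supset\langle b_1,b_2\rangle=\langle a_1\backslash b_1,a_1\sqcap b_2\rangle$. For $\mathbf L=\mathbf A^-$ (with maximum $\top^A$) this gives $\mathbf B$; $\langle\mathbf A^+\odot\mathbf A^+,\supset\rangle$ denotes the structure formed in the same way from $\mathbf A^+$. A homomorphism (resp. embedding) from a residuated De Morgan lattice into an implicative bilattice is a map (resp. injective map) preserving $\land,\lor,\supset,\neg,\top$; a homomorphism between implicative bilattices preserves all operations. The embedding $h$ meant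 in (iii) and (iv) is $h(a)=\langle a\land^A\top^A,\ \neg^A a\land^A\top^A\rangle$.
   Formalization: In (iii), A⁺ ⊙ A⁺ is formed from A⁺ with its order reversed, so that ⊤ is its maximum, because A⁺ in its own order need not have a maximum and a\b would then be undefined. *)

theory Defs
  imports "HOL-Algebra.Congruence"
begin

text \<open>
  All algebras are records of operations with an explicit carrier; the operations are only
  constrained on the carrier. Lattices are taken in the algebraic signature, since several
  lattice structures live on one carrier and on subsets of it.
\<close>

record 'a lattice_rec = "'a partial_object" +
  meet :: "['a, 'a] \<Rightarrow> 'a" (infixl "\<sqinter>\<index>" 70)
  join :: "['a, 'a] \<Rightarrow> 'a" (infixl "\<squnion>\<index>" 65)

record 'a imp_neg_lattice_rec = "'a lattice_rec" +
  imp :: "['a, 'a] \<Rightarrow> 'a" (infixr "\<hookrightarrow>\<index>" 60)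
  neg :: "'a \<Rightarrow> 'a" ("\<sim>\<index> _" [81] 80)

record 'a residuated_rec = "'a imp_neg_lattice_rec" +
  tt :: 'a ("\<top>\<index>")

record 'a bilattice_rec = "'a imp_neg_lattice_rec" +
  kmeet :: "['a, 'a] \<Rightarrow> 'a" (infixl "\<otimes>\<index>" 70)
  kjoin :: "['a, 'a] \<Rightarrow> 'a" (infixl "\<oplus>\<index>" 65)


definition leq :: "('a, 'm) lattice_rec_scheme \<Rightarrow> 'a \<Rightarrow> 'a \<Rightarrow> bool" (infix "\<sqsubseteq>\<index>" 50)
  where "x \<sqsubseteq>\<^bsub>L\<^esub> y \<longleftrightarrow> x \<sqinter>\<^bsub>L\<^esub> y = x"

locale lattice_algebra =
  fixes L :: "('a, 'm) lattice_rec_scheme" (structure)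
  assumes nonempty: "carrier L \<noteq> {}"
    and meet_closed: "\<lbrakk>x \<in> carrier L; y \<in> carrier L\<rbrakk> \<Longrightarrow> x \<sqinter> y \<in> carrier L"
    and join_closed: "\<lbrakk>x \<in> carrier L; y \<in> carrier L\<rbrakk> \<Longrightarrow> x \<squnion> y \<in> carrier L"
    and meet_comm: "\<lbrakk>x \<in> carrier L; y \<in> carrier L\<rbrakk> \<Longrightarrow> x \<sqinter> y = y \<sqinter> x"
    and join_comm: "\<lbrakk>x \<in> carrier L; y \<in> carrier L\<rbrakk> \<Longrightarrow> x \<squnion> y = y \<squnion> x"
    and meet_assoc: "\<lbrakk>x \<in> carrier L; y \<in> carrier L; z \<in> carrier L\<rbrakk>
      \<Longrightarrow> (x \<sqinter> y) \<sqinter> z = x \<sqinter> (y \<sqinter> z)"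
    and join_assoc: "\<lbrakk>x \<in> carrier L; y \<in> carrier L; z \<in> carrier L\<rbrakk>
      \<Longrightarrow> (x \<squnion> y) \<squnion> z = x \<squnion> (y \<squnion> z)"
    and meet_join_absorb: "\<lbrakk>x \<in> carrier L; y \<in> carrier L\<rbrakk> \<Longrightarrow> x \<sqinter> (x \<squnion> y) = x"
    and join_meet_absorb: "\<lbrakk>x \<in> carrier L; y \<in> carrier L\<rbrakk> \<Longrightarrow> x \<squnion> (x \<sqinter> y) = x"

locale de_morgan_lattice = lattice_algebra A
  for A :: "('a, 'm) imp_neg_lattice_rec_scheme" (structure) +
  assumes distrib: "\<lbrakk>x \<in> carrier A; y \<in> carrier A; z \<in> carrier A\<rbrakk>
      \<Longrightarrow> x \<sqinter> (y \<squnion> z) = (x \<sqinter> y) \<squnion> (x \<sqinter> z)"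
    and neg_closed: "x \<in> carrier A \<Longrightarrow> \<sim> x \<in> carrier A"
    and neg_neg: "x \<in> carrier A \<Longrightarrow> \<sim> (\<sim> x) = x"
    and neg_antitone: "\<lbrakk>x \<in> carrier A; y \<in> carrier A; x \<sqsubseteq> y\<rbrakk> \<Longrightarrow> \<sim> y \<sqsubseteq> \<sim> x"

locale residuated_de_morgan_lattice = de_morgan_lattice A
  for A :: "('a, 'm) residuated_rec_scheme" (structure) +
  assumes imp_closed: "\<lbrakk>x \<in> carrier A; y \<in> carrier A\<rbrakk> \<Longrightarrow> x \<hookrightarrow> y \<in> carrier A"
    and tt_closed: "\<top> \<in> carrier A"
    and RD0: "\<top> = \<sim> \<top>"
    and RD1: "x \<in> carrier A \<Longrightarrow> \<top> \<hookrightarrow> x = x"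
    and RD2: "\<lbrakk>x \<in> carrier A; y \<in> carrier A; z \<in> carrier A\<rbrakk>
      \<Longrightarrow> x \<hookrightarrow> (y \<hookrightarrow> z) = (x \<sqinter> y) \<hookrightarrow> z"
    and RD3: "\<lbrakk>x \<in> carrier A; y \<in> carrier A\<rbrakk>
      \<Longrightarrow> \<top> \<sqinter> (((x \<hookrightarrow> y) \<hookrightarrow> x) \<hookrightarrow> x) = \<top>"
    and RD4: "\<lbrakk>x \<in> carrier A; y \<in> carrier A; z \<in> carrier A\<rbrakk>
      \<Longrightarrow> (x \<squnion> y) \<hookrightarrow> z = (x \<hookrightarrow> z) \<sqinter> (y \<hookrightarrow> z)"
    and RD5: "\<lbrakk>x \<in> carrier A; y \<in> carrier A\<rbrakk>
      \<Longrightarrow> x \<sqinter> (((x \<hookrightarrow> y) \<sqinter> ((\<sim> y) \<hookrightarrow> (\<sim> x))) \<hookrightarrow> y) = x"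
    and RD6: "\<lbrakk>x \<in> carrier A; y \<in> carrier A; z \<in> carrier A\<rbrakk>
      \<Longrightarrow> (\<sim> (x \<hookrightarrow> y)) \<hookrightarrow> z = (x \<sqinter> (\<sim> y)) \<hookrightarrow> z"

definition k_lattice :: "('a, 'm) bilattice_rec_scheme \<Rightarrow> 'a lattice_rec"
  where "k_lattice B = \<lparr>carrier = carrier B, meet = kmeet B, join = kjoin B\<rparr>"

locale bilattice = lattice_algebra B + knowledge: lattice_algebra "k_lattice B"
  for B :: "('a, 'm) bilattice_rec_scheme" (structure) +
  assumes neg_closed: "x \<in> carrier B \<Longrightarrow> \<sim> x \<in> carrier B"
    and neg_antitone: "\<lbrakk>x \<in> carrier B; y \<in> carrier B; x \<sqsubseteq> y\<rbrakk> \<Longrightarrow> \<sim> y \<sqsubseteq> \<sim> x"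
    and neg_k_mono: "\<lbrakk>x \<in> carrier B; y \<in> carrier B; x \<sqsubseteq>\<^bsub>k_lattice B\<^esub> y\<rbrakk>
      \<Longrightarrow> \<sim> x \<sqsubseteq>\<^bsub>k_lattice B\<^esub> \<sim> y"
    and neg_neg: "x \<in> carrier B \<Longrightarrow> \<sim> (\<sim> x) = x"

locale implicative_bilattice = bilattice B
  for B :: "('a, 'm) bilattice_rec_scheme" (structure) +
  assumes imp_closed: "\<lbrakk>x \<in> carrier B; y \<in> carrier B\<rbrakk> \<Longrightarrow> x \<hookrightarrow> y \<in> carrier B"
    and IB1: "\<lbrakk>x \<in> carrier B; y \<in> carrier B\<rbrakk> \<Longrightarrow> (x \<hookrightarrow> x) \<hookrightarrow> y = y"
    and IB2_meet: "\<lbrakk>x \<in> carrier B; y \<in> carrier B; z \<in> carrier B\<rbrakk>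
      \<Longrightarrow> x \<hookrightarrow> (y \<hookrightarrow> z) = (x \<sqinter> y) \<hookrightarrow> z"
    and IB2_kmeet: "\<lbrakk>x \<in> carrier B; y \<in> carrier B; z \<in> carrier B\<rbrakk>
      \<Longrightarrow> (x \<sqinter> y) \<hookrightarrow> z = (x \<otimes> y) \<hookrightarrow> z"
    and IB3: "\<lbrakk>x \<in> carrier B; y \<in> carrier B\<rbrakk>
      \<Longrightarrow> ((x \<hookrightarrow> y) \<hookrightarrow> x) \<hookrightarrow> x = x \<hookrightarrow> x"
    and IB4_join: "\<lbrakk>x \<in> carrier B; y \<in> carrier B; z \<in> carrier B\<rbrakk>
      \<Longrightarrow> (x \<squnion> y) \<hookrightarrow> z = (x \<hookrightarrow> z) \<sqinter> (y \<hookrightarrow> z)"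
    and IB4_kjoin: "\<lbrakk>x \<in> carrier B; y \<in> carrier B; z \<in> carrier B\<rbrakk>
      \<Longrightarrow> (x \<hookrightarrow> z) \<sqinter> (y \<hookrightarrow> z) = (x \<oplus> y) \<hookrightarrow> z"
    and IB5: "\<lbrakk>x \<in> carrier B; y \<in> carrier B\<rbrakk>
      \<Longrightarrow> x \<sqinter> ((x \<hookrightarrow> y) \<hookrightarrow> (x \<otimes> y)) = x"
    and IB6: "\<lbrakk>x \<in> carrier B; y \<in> carrier B; z \<in> carrier B\<rbrakk>
      \<Longrightarrow> (\<sim> (x \<hookrightarrow> y)) \<hookrightarrow> z = (x \<sqinter> (\<sim> y)) \<hookrightarrow> z"

text \<open>Implicative bilattices have no constant in their signature; in them the term below
  takes the same value at every element.\<close>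

definition bilattice_top :: "('a, 'm) bilattice_rec_scheme \<Rightarrow> 'a"
  where "bilattice_top B =
    (THE t. \<forall>x\<in>carrier B.
       (x \<hookrightarrow>\<^bsub>B\<^esub> x) \<oplus>\<^bsub>B\<^esub> (\<sim>\<^bsub>B\<^esub> (x \<hookrightarrow>\<^bsub>B\<^esub> x)) = t)"


definition is_rel_complement :: "('a, 'm) lattice_rec_scheme \<Rightarrow> 'a \<Rightarrow> 'a \<Rightarrow> 'a \<Rightarrow> 'a \<Rightarrow> bool"
  where "is_rel_complement L l u a c \<longleftrightarrow>
    c \<in> carrier L \<and> l \<sqsubseteq>\<^bsub>L\<^esub> c \<and> c \<sqsubseteq>\<^bsub>L\<^esub> u \<and> a \<sqinter>\<^bsub>L\<^esub> c = l \<and> a \<squnion>\<^bsub>L\<^esub> c = u"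

definition relatively_complemented :: "('a, 'm) lattice_rec_scheme \<Rightarrow> bool"
  where "relatively_complemented L \<longleftrightarrow> lattice_algebra L \<and>
    (\<forall>l\<in>carrier L. \<forall>u\<in>carrier L. \<forall>a\<in>carrier L.
       l \<sqsubseteq>\<^bsub>L\<^esub> a \<and> a \<sqsubseteq>\<^bsub>L\<^esub> u \<longrightarrow> (\<exists>c. is_rel_complement L l u a c))"

definition lattice_max :: "('a, 'm) lattice_rec_scheme \<Rightarrow> 'a"
  where "lattice_max L = (THE m. m \<in> carrier L \<and> (\<forall>x\<in>carrier L. x \<sqsubseteq>\<^bsub>L\<^esub> m))"

definition rel_imp :: "('a, 'm) lattice_rec_scheme \<Rightarrow> 'a \<Rightarrow> 'a \<Rightarrow> 'a"
  where "rel_imp L a b = (THE c. is_rel_complement L (a \<sqinter>\<^bsub>L\<^esub> b) (lattice_max L) a c)"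

definition product_bilattice :: "('a, 'm) lattice_rec_scheme \<Rightarrow> ('a \<times> 'a) bilattice_rec"
  where "product_bilattice L =
    \<lparr>carrier = carrier L \<times> carrier L,
     meet = (\<lambda>(a1, a2) (b1, b2). (a1 \<sqinter>\<^bsub>L\<^esub> b1, a2 \<squnion>\<^bsub>L\<^esub> b2)),
     join = (\<lambda>(a1, a2) (b1, b2). (a1 \<squnion>\<^bsub>L\<^esub> b1, a2 \<sqinter>\<^bsub>L\<^esub> b2)),
     imp = (\<lambda>(a1, a2) (b1, b2). (rel_imp L a1 b1, a1 \<sqinter>\<^bsub>L\<^esub> b2)),
     neg = (\<lambda>(a1, a2). (a2, a1)),
     kmeet = (\<lambda>(a1, a2) (b1, b2). (a1 \<sqinter>\<^bsub>L\<^esub> b1, a2 \<sqinter>\<^bsub>L\<^esub> b2)),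
     kjoin = (\<lambda>(a1, a2) (b1, b2). (a1 \<squnion>\<^bsub>L\<^esub> b1, a2 \<squnion>\<^bsub>L\<^esub> b2))\<rparr>"

definition dual_lattice :: "('a, 'm) lattice_rec_scheme \<Rightarrow> 'a lattice_rec"
  where "dual_lattice L = \<lparr>carrier = carrier L, meet = join L, join = meet L\<rparr>"

definition dually_isomorphic ::
    "('a, 'm) lattice_rec_scheme \<Rightarrow> ('b, 'n) lattice_rec_scheme \<Rightarrow> bool"
  where "dually_isomorphic L M \<longleftrightarrow>
    (\<exists>\<phi>. bij_betw \<phi> (carrier L) (carrier M) \<and>
       (\<forall>x\<in>carrier L. \<forall>y\<in>carrier L.
          \<phi> (x \<sqinter>\<^bsub>L\<^esub> y) = \<phi> x \<squnion>\<^bsub>M\<^esub> \<phi> y \<and>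
          \<phi> (x \<squnion>\<^bsub>L\<^esub> y) = \<phi> x \<sqinter>\<^bsub>M\<^esub> \<phi> y))"


definition minus_part :: "('a, 'm) residuated_rec_scheme \<Rightarrow> 'a lattice_rec"
  where "minus_part A =
    \<lparr>carrier = {a \<in> carrier A. a \<sqsubseteq>\<^bsub>A\<^esub> \<top>\<^bsub>A\<^esub>}, meet = meet A, join = join A\<rparr>"

definition plus_part :: "('a, 'm) residuated_rec_scheme \<Rightarrow> 'a lattice_rec"
  where "plus_part A =
    \<lparr>carrier = {a \<in> carrier A. \<top>\<^bsub>A\<^esub> \<sqsubseteq>\<^bsub>A\<^esub> a}, meet = meet A, join = join A\<rparr>"

definition minus_bilattice :: "('a, 'm) residuated_rec_scheme \<Rightarrow> ('a \<times> 'a) bilattice_rec"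
  where "minus_bilattice A = product_bilattice (minus_part A)"

text \<open>\<open>\<top>\<close> is the least element of \<open>plus_part A\<close>, which in general has no greatest element,
  whereas the product construction needs one; moreover \<open>\<top>\<close> has to become the top of the
  knowledge order. The construction is therefore applied to the order dual.\<close>

definition plus_bilattice :: "('a, 'm) residuated_rec_scheme \<Rightarrow> ('a \<times> 'a) bilattice_rec"
  where "plus_bilattice A = product_bilattice (dual_lattice (plus_part A))"

definition canonical_map :: "('a, 'm) residuated_rec_scheme \<Rightarrow> 'a \<Rightarrow> 'a \<times> 'a"
  where "canonical_map A a = (a \<sqinter>\<^bsub>A\<^esub> \<top>\<^bsub>A\<^esub>, (\<sim>\<^bsub>A\<^esub> a) \<sqinter>\<^bsub>A\<^esub> \<top>\<^bsub>A\<^esub>)"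


definition residuated_bilattice_hom ::
    "('a, 'm) residuated_rec_scheme \<Rightarrow> ('b, 'n) bilattice_rec_scheme \<Rightarrow> ('a \<Rightarrow> 'b) \<Rightarrow> bool"
  where "residuated_bilattice_hom A B f \<longleftrightarrow>
    f \<in> carrier A \<rightarrow> carrier B \<and>
    (\<forall>x\<in>carrier A. \<forall>y\<in>carrier A.
       f (x \<sqinter>\<^bsub>A\<^esub> y) = f x \<sqinter>\<^bsub>B\<^esub> f y \<and>
       f (x \<squnion>\<^bsub>A\<^esub> y) = f x \<squnion>\<^bsub>B\<^esub> f y \<and>
       f (x \<hookrightarrow>\<^bsub>A\<^esub> y) = f x \<hookrightarrow>\<^bsub>B\<^esub> f y) \<and>
    (\<forall>x\<in>carrier A. f (\<sim>\<^bsub>A\<^esub> x) = \<sim>\<^bsub>B\<^esub> (f x)) \<and>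
    f \<top>\<^bsub>A\<^esub> = bilattice_top B"

definition residuated_bilattice_embedding ::
    "('a, 'm) residuated_rec_scheme \<Rightarrow> ('b, 'n) bilattice_rec_scheme \<Rightarrow> ('a \<Rightarrow> 'b) \<Rightarrow> bool"
  where "residuated_bilattice_embedding A B f \<longleftrightarrow>
    residuated_bilattice_hom A B f \<and> inj_on f (carrier A)"

definition implicative_bilattice_hom ::
    "('a, 'm) bilattice_rec_scheme \<Rightarrow> ('b, 'n) bilattice_rec_scheme \<Rightarrow> ('a \<Rightarrow> 'b) \<Rightarrow> bool"
  where "implicative_bilattice_hom B C g \<longleftrightarrow>
    g \<in> carrier B \<rightarrow> carrier C \<and>
    (\<forall>x\<in>carrier B. \<forall>y\<in>carrier B.
       g (x \<sqinter>\<^bsub>B\<^esub> y) = g x \<sqinter>\<^bsub>C\<^esub> g y \<and>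
       g (x \<squnion>\<^bsub>B\<^esub> y) = g x \<squnion>\<^bsub>C\<^esub> g y \<and>
       g (x \<otimes>\<^bsub>B\<^esub> y) = g x \<otimes>\<^bsub>C\<^esub> g y \<and>
       g (x \<oplus>\<^bsub>B\<^esub> y) = g x \<oplus>\<^bsub>C\<^esub> g y \<and>
       g (x \<hookrightarrow>\<^bsub>B\<^esub> y) = g x \<hookrightarrow>\<^bsub>C\<^esub> g y) \<and>
    (\<forall>x\<in>carrier B. g (\<sim>\<^bsub>B\<^esub> x) = \<sim>\<^bsub>C\<^esub> (g x))"

text \<open>Extensionality makes a map on the carrier of the product bilattice a single HOL function,
  so that \<open>\<exists>!\<close> expresses uniqueness of maps defined on that carrier.\<close>

definition bilattice_extension ::
    "('a, 'm) residuated_rec_scheme \<Rightarrow> ('b, 'n) bilattice_rec_scheme \<Rightarrow>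
     ('a \<Rightarrow> 'b) \<Rightarrow> ('a \<times> 'a \<Rightarrow> 'b) \<Rightarrow> bool"
  where "bilattice_extension A C f g \<longleftrightarrow>
    g \<in> carrier (minus_bilattice A) \<rightarrow>\<^sub>E carrier C \<and>
    implicative_bilattice_hom (minus_bilattice A) C g \<and>
    (\<forall>a\<in>carrier A. g (canonical_map A a) = f a)"

end

theory Submission
  imports Defs
begin

text \<open>
  In a residuated De Morgan lattice \<open>\<top> \<sqsubseteq> x \<hookrightarrow> y\<close> holds exactly when \<open>x \<sqinter> \<top> \<sqsubseteq> y\<close>, so \<open>(x \<hookrightarrow> y) \<sqinter> \<top>\<close>
  is the residual of the part below \<open>\<top>\<close>; Peirce's law (RD3) makes it a relative complement, and
  negation carries this to the part above \<open>\<top>\<close>. Since RD6 gives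
  \<open>\<sim> (x \<hookrightarrow> y) \<sqinter> \<top> = x \<sqinter> \<sim> y \<sqinter> \<top>\<close>, the canonical map is an embedding.

  Call an element of an implicative bilattice designated if \<open>z \<hookrightarrow> z = z\<close>, and \<open>x, y\<close> equivalent if
  \<open>x \<hookrightarrow> z = y \<hookrightarrow> z\<close> for all \<open>z\<close>. In a product over \<open>L\<close> these say that the first coordinate of
  \<open>z\<close> is the maximum and that \<open>x, y\<close> have the same first coordinate. IB5 gives \<open>x \<sqsubseteq> y\<close> as soon as
  \<open>x \<hookrightarrow> y\<close> and \<open>\<sim> y \<hookrightarrow> \<sim> x\<close> are designated, hence \<open>x = y\<close> if both \<open>x, y\<close> and \<open>\<sim> x, \<sim> y\<close> are
  equivalent. The only candidate extension of \<open>f\<close> is \<open>(a, b) \<mapsto> f a \<otimes> \<sim> (f b)\<close>, because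
  \<open>(a, b) = h a \<otimes> \<sim> (h b)\<close> below \<open>\<top>\<close>; it is equivalent to \<open>f a\<close> and its negation to \<open>f b\<close>, so
  that the homomorphism equations can be checked up to equivalence. Injectivity passes to the
  extension because \<open>h a = (a, b) \<sqinter> h \<top>\<close>.
\<close>

section \<open>Lattices in the algebraic signature\<close>

lemma k_lattice_sels:
  "carrier (k_lattice B) = carrier B" "meet (k_lattice B) = kmeet B" "join (k_lattice B) = kjoin B"
  by (simp_all add: k_lattice_def)

lemma product_sels:
  "carrier (product_bilattice L) = carrier L \<times> carrier L"
  "(a1, a2) \<sqinter>\<^bsub>product_bilattice L\<^esub> (b1, b2) = (a1 \<sqinter>\<^bsub>L\<^esub> b1, a2 \<squnion>\<^bsub>L\<^esub> b2)"
  "(a1, a2) \<squnion>\<^bsub>product_bilattice L\<^esub> (b1, b2) = (a1 \<squnion>\<^bsub>L\<^esub> b1, a2 \<sqinter>\<^bsub>L\<^esub> b2)"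
  "(a1, a2) \<hookrightarrow>\<^bsub>product_bilattice L\<^esub> (b1, b2) = (rel_imp L a1 b1, a1 \<sqinter>\<^bsub>L\<^esub> b2)"
  "\<sim>\<^bsub>product_bilattice L\<^esub> (a1, a2) = (a2, a1)"
  "(a1, a2) \<otimes>\<^bsub>product_bilattice L\<^esub> (b1, b2) = (a1 \<sqinter>\<^bsub>L\<^esub> b1, a2 \<sqinter>\<^bsub>L\<^esub> b2)"
  "(a1, a2) \<oplus>\<^bsub>product_bilattice L\<^esub> (b1, b2) = (a1 \<squnion>\<^bsub>L\<^esub> b1, a2 \<squnion>\<^bsub>L\<^esub> b2)"
  by (simp_all add: product_bilattice_def)

context lattice_algebra
begin

lemma meet_idem: "x \<in> carrier L \<Longrightarrow> x \<sqinter> x = x"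
  by (metis join_closed join_meet_absorb meet_closed meet_join_absorb)

lemma join_idem: "x \<in> carrier L \<Longrightarrow> x \<squnion> x = x"
  by (metis join_closed join_meet_absorb meet_closed meet_join_absorb)

lemma meet_left_comm:
  "\<lbrakk>x \<in> carrier L; y \<in> carrier L; z \<in> carrier L\<rbrakk> \<Longrightarrow> x \<sqinter> (y \<sqinter> z) = y \<sqinter> (x \<sqinter> z)"
  by (metis meet_assoc meet_comm)

lemma join_left_comm:
  "\<lbrakk>x \<in> carrier L; y \<in> carrier L; z \<in> carrier L\<rbrakk> \<Longrightarrow> x \<squnion> (y \<squnion> z) = y \<squnion> (x \<squnion> z)"
  by (metis join_assoc join_comm)

lemma meet_left_idem: "\<lbrakk>x \<in> carrier L; y \<in> carrier L\<rbrakk> \<Longrightarrow> x \<sqinter> (x \<sqinter> y) = x \<sqinter> y"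
  by (metis meet_assoc meet_idem)

lemmas meet_ac = meet_assoc meet_comm meet_left_comm meet_idem meet_left_idem
lemmas join_ac = join_assoc join_comm join_left_comm join_idem

lemma leq_refl: "x \<in> carrier L \<Longrightarrow> x \<sqsubseteq> x"
  by (simp add: leq_def meet_idem)

lemma leq_antisym: "\<lbrakk>x \<in> carrier L; y \<in> carrier L; x \<sqsubseteq> y; y \<sqsubseteq> x\<rbrakk> \<Longrightarrow> x = y"
  by (metis leq_def meet_comm)

lemma leq_trans:
  "\<lbrakk>x \<in> carrier L; y \<in> carrier L; z \<in> carrier L; x \<sqsubseteq> y; y \<sqsubseteq> z\<rbrakk> \<Longrightarrow> x \<sqsubseteq> z"
  by (metis leq_def meet_assoc)

lemma meet_leq1: "\<lbrakk>x \<in> carrier L; y \<in> carrier L\<rbrakk> \<Longrightarrow> x \<sqinter> y \<sqsubseteq> x"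
  by (simp add: leq_def meet_ac meet_closed)

lemma meet_leq2: "\<lbrakk>x \<in> carrier L; y \<in> carrier L\<rbrakk> \<Longrightarrow> x \<sqinter> y \<sqsubseteq> y"
  by (simp add: leq_def meet_ac meet_closed)

lemma leq_iff_join: "\<lbrakk>x \<in> carrier L; y \<in> carrier L\<rbrakk> \<Longrightarrow> x \<sqsubseteq> y \<longleftrightarrow> x \<squnion> y = y"
  by (metis join_comm join_meet_absorb leq_def meet_comm meet_join_absorb)

lemma join_eq_iff_meet_eq:
  assumes "x \<in> carrier L" "y \<in> carrier L"
  shows "x \<squnion> y = x \<longleftrightarrow> x \<sqinter> y = y" "x \<squnion> y = y \<longleftrightarrow> x \<sqinter> y = x"
  using assms by (metis join_comm leq_def leq_iff_join meet_comm)+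

lemma leq_join1: "\<lbrakk>x \<in> carrier L; y \<in> carrier L\<rbrakk> \<Longrightarrow> x \<sqsubseteq> x \<squnion> y"
  by (simp add: leq_def meet_join_absorb)

lemma leq_join2: "\<lbrakk>x \<in> carrier L; y \<in> carrier L\<rbrakk> \<Longrightarrow> y \<sqsubseteq> x \<squnion> y"
  by (metis leq_join1 join_comm)

lemma leq_meetI:
  "\<lbrakk>x \<in> carrier L; y \<in> carrier L; z \<in> carrier L; z \<sqsubseteq> x; z \<sqsubseteq> y\<rbrakk> \<Longrightarrow> z \<sqsubseteq> x \<sqinter> y"
  by (metis leq_def meet_assoc)

lemma join_leqI:
  "\<lbrakk>x \<in> carrier L; y \<in> carrier L; z \<in> carrier L; x \<sqsubseteq> z; y \<sqsubseteq> z\<rbrakk> \<Longrightarrow> x \<squnion> y \<sqsubseteq> z"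
  by (metis join_assoc join_closed leq_iff_join)

text \<open>An order-reversing self-inverse map exchanges greatest lower and least upper bounds. The
  map \<open>n\<close> is arbitrary so that the negations of De Morgan lattices and of bilattices
  are both instances.\<close>

lemma antitone_involution_meet:
  assumes n: "\<And>x. x \<in> carrier L \<Longrightarrow> n x \<in> carrier L" "\<And>x. x \<in> carrier L \<Longrightarrow> n (n x) = x"
    "\<And>x y. \<lbrakk>x \<in> carrier L; y \<in> carrier L; x \<sqsubseteq> y\<rbrakk> \<Longrightarrow> n y \<sqsubseteq> n x"
    and [simp]: "x \<in> carrier L" "y \<in> carrier L"
  shows "n (x \<sqinter> y) = n x \<squnion> n y"
proof (rule leq_antisym)
  note [simp] = n(1,2) meet_closed join_closed
  show "n x \<squnion> n y \<sqsubseteq> n (x \<sqinter> y)"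
    by (intro join_leqI n(3)) (simp_all add: meet_leq1 meet_leq2)
  have "n (n x \<squnion> n y) \<sqsubseteq> x" "n (n x \<squnion> n y) \<sqsubseteq> y"
    using n(3)[of "n x" "n x \<squnion> n y"] n(3)[of "n y" "n x \<squnion> n y"]
    by (simp_all add: leq_join1 leq_join2)
  then have "n (n x \<squnion> n y) \<sqsubseteq> x \<sqinter> y" by (intro leq_meetI) simp_all
  then show "n (x \<sqinter> y) \<sqsubseteq> n x \<squnion> n y"
    using n(3)[of "n (n x \<squnion> n y)" "x \<sqinter> y"] by simp
qed (simp_all add: n meet_closed join_closed)

lemma antitone_involution_join:
  assumes n: "\<And>x. x \<in> carrier L \<Longrightarrow> n x \<in> carrier L" "\<And>x. x \<in> carrier L \<Longrightarrow> n (n x) = x"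
    "\<And>x y. \<lbrakk>x \<in> carrier L; y \<in> carrier L; x \<sqsubseteq> y\<rbrakk> \<Longrightarrow> n y \<sqsubseteq> n x"
    and "x \<in> carrier L" "y \<in> carrier L"
  shows "n (x \<squnion> y) = n x \<sqinter> n y"
  using antitone_involution_meet[OF n, of "n x" "n y"] n(2)[of "n x \<sqinter> n y"] assms
  by (simp add: meet_closed)

text \<open>Negation in a bilattice preserves the knowledge order, so this order-preserving
  counterpart is applied to \<open>k_lattice B\<close>.\<close>

lemma monotone_involution_meet:
  assumes n: "\<And>x. x \<in> carrier L \<Longrightarrow> n x \<in> carrier L" "\<And>x. x \<in> carrier L \<Longrightarrow> n (n x) = x"
    "\<And>x y. \<lbrakk>x \<in> carrier L; y \<in> carrier L; x \<sqsubseteq> y\<rbrakk> \<Longrightarrow> n x \<sqsubseteq> n y"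
    and [simp]: "x \<in> carrier L" "y \<in> carrier L"
  shows "n (x \<sqinter> y) = n x \<sqinter> n y"
proof (rule leq_antisym)
  note [simp] = n(1,2) meet_closed
  show "n (x \<sqinter> y) \<sqsubseteq> n x \<sqinter> n y"
    by (intro leq_meetI n(3)) (simp_all add: meet_leq1 meet_leq2)
  have "n (n x \<sqinter> n y) \<sqsubseteq> x" "n (n x \<sqinter> n y) \<sqsubseteq> y"
    using n(3)[of "n x \<sqinter> n y" "n x"] n(3)[of "n x \<sqinter> n y" "n y"]
    by (simp_all add: meet_leq1 meet_leq2)
  then have "n (n x \<sqinter> n y) \<sqsubseteq> x \<sqinter> y" by (intro leq_meetI) simp_all
  then show "n x \<sqinter> n y \<sqsubseteq> n (x \<sqinter> y)"
    using n(3)[of "n (n x \<sqinter> n y)" "x \<sqinter> y"] by simp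
qed (simp_all add: n meet_closed)

lemma monotone_involution_join:
  assumes n: "\<And>x. x \<in> carrier L \<Longrightarrow> n x \<in> carrier L" "\<And>x. x \<in> carrier L \<Longrightarrow> n (n x) = x"
    "\<And>x y. \<lbrakk>x \<in> carrier L; y \<in> carrier L; x \<sqsubseteq> y\<rbrakk> \<Longrightarrow> n x \<sqsubseteq> n y"
    and [simp]: "x \<in> carrier L" "y \<in> carrier L"
  shows "n (x \<squnion> y) = n x \<squnion> n y"
proof (rule leq_antisym)
  note [simp] = n(1,2) join_closed
  show "n x \<squnion> n y \<sqsubseteq> n (x \<squnion> y)"
    by (intro join_leqI n(3)) (simp_all add: leq_join1 leq_join2)
  have "x \<sqsubseteq> n (n x \<squnion> n y)" "y \<sqsubseteq> n (n x \<squnion> n y)"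
    using n(3)[of "n x" "n x \<squnion> n y"] n(3)[of "n y" "n x \<squnion> n y"]
    by (simp_all add: leq_join1 leq_join2)
  then have "x \<squnion> y \<sqsubseteq> n (n x \<squnion> n y)" by (intro join_leqI) simp_all
  then show "n (x \<squnion> y) \<sqsubseteq> n x \<squnion> n y"
    using n(3)[of "x \<squnion> y" "n (n x \<squnion> n y)"] by simp
qed (simp_all add: n join_closed)

lemma leq_dual_lattice:
  "\<lbrakk>x \<in> carrier L; y \<in> carrier L\<rbrakk> \<Longrightarrow> x \<sqsubseteq>\<^bsub>dual_lattice L\<^esub> y \<longleftrightarrow> y \<sqsubseteq> x"
  by (simp add: dual_lattice_def leq_def join_eq_iff_meet_eq meet_comm)

end

section \<open>Distributive lattices, uniqueness of relative complements, order duals\<close>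

locale distributive_lattice_algebra = lattice_algebra L
  for L :: "('a, 'm) lattice_rec_scheme" (structure) +
  assumes meet_join_distrib: "\<lbrakk>x \<in> carrier L; y \<in> carrier L; z \<in> carrier L\<rbrakk>
      \<Longrightarrow> x \<sqinter> (y \<squnion> z) = (x \<sqinter> y) \<squnion> (x \<sqinter> z)"
begin

lemma join_meet_distrib:
  assumes "x \<in> carrier L" "y \<in> carrier L" "z \<in> carrier L"
  shows "x \<squnion> (y \<sqinter> z) = (x \<squnion> y) \<sqinter> (x \<squnion> z)"
proof -
  have "(x \<squnion> y) \<sqinter> (x \<squnion> z) = ((x \<squnion> y) \<sqinter> x) \<squnion> ((x \<squnion> y) \<sqinter> z)"
    by (simp add: assms meet_join_distrib join_closed)
  also have "(x \<squnion> y) \<sqinter> x = x"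
    by (metis assms meet_comm meet_join_absorb join_closed)
  also have "(x \<squnion> y) \<sqinter> z = (x \<sqinter> z) \<squnion> (y \<sqinter> z)"
    using meet_join_distrib[of z x y] by (simp add: assms meet_comm join_closed)
  also have "x \<squnion> ((x \<sqinter> z) \<squnion> (y \<sqinter> z)) = x \<squnion> (y \<sqinter> z)"
    by (metis assms join_assoc join_meet_absorb meet_closed)
  finally show ?thesis ..
qed

text \<open>Absorption replaces \<open>x\<close> by \<open>x \<sqinter> (y \<squnion> z)\<close>,
  and distributing leaves an expression symmetric in \<open>x\<close> and \<open>y\<close>. This
  gives uniqueness of relative complements and, later, injectivity of the canonical map.\<close>

lemma meet_join_cancel:
  assumes "x \<in> carrier L" "y \<in> carrier L" "z \<in> carrier L"
    and "x \<sqinter> z = y \<sqinter> z" "x \<squnion> z = y \<squnion> z"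
  shows "x = y"
proof -
  have "x = x \<sqinter> (y \<squnion> z)" by (metis assms(1,3,5) meet_join_absorb)
  also have "\<dots> = (x \<sqinter> y) \<squnion> (x \<sqinter> z)" using assms by (simp add: meet_join_distrib)
  also have "\<dots> = (y \<sqinter> x) \<squnion> (y \<sqinter> z)" using assms by (simp add: meet_comm)
  also have "\<dots> = y \<sqinter> (x \<squnion> z)" using assms(1-3) by (simp add: meet_join_distrib)
  also have "\<dots> = y" by (metis assms(2,3,5) meet_join_absorb)
  finally show ?thesis .
qed

lemma is_rel_complement_unique:
  assumes "a \<in> carrier L" "is_rel_complement L l u a c" "is_rel_complement L l u a d"
  shows "c = d"
  using assms meet_join_cancel[of c d a]
  by (auto simp: is_rel_complement_def meet_comm join_comm)

lemma distributive_dual_lattice: "distributive_lattice_algebra (dual_lattice L)"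
  by unfold_locales
    (auto simp: dual_lattice_def nonempty meet_closed join_closed meet_ac join_ac
      meet_join_absorb join_meet_absorb join_meet_distrib)

end

lemma relatively_complemented_dual_lattice:
  assumes "distributive_lattice_algebra L" "relatively_complemented L"
  shows "relatively_complemented (dual_lattice L)"
proof -
  interpret distributive_lattice_algebra L by fact
  have carrier: "carrier (dual_lattice L) = carrier L" by (simp add: dual_lattice_def)
  show ?thesis unfolding relatively_complemented_def
  proof (intro conjI ballI impI)
    show "lattice_algebra (dual_lattice L)"
      using distributive_dual_lattice by (rule distributive_lattice_algebra.axioms)
    fix l u a
    assume "l \<in> carrier (dual_lattice L)" "u \<in> carrier (dual_lattice L)"
      "a \<in> carrier (dual_lattice L)" "l \<sqsubseteq>\<^bsub>dual_lattice L\<^esub> a \<and> a \<sqsubseteq>\<^bsub>dual_lattice L\<^esub> u"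
    then have cl: "l \<in> carrier L" "u \<in> carrier L" "a \<in> carrier L"
      and "u \<sqsubseteq>\<^bsub>L\<^esub> a" "a \<sqsubseteq>\<^bsub>L\<^esub> l"
      by (simp_all add: carrier leq_dual_lattice)
    \<comment> \<open>An interval of the dual is an interval of \<open>L\<close> with its ends
      exchanged, and complements in it are the same elements.\<close>
    then obtain c where "is_rel_complement L u l a c"
      using assms(2) unfolding relatively_complemented_def by blast
    then have "is_rel_complement (dual_lattice L) l u a c"
      using cl unfolding is_rel_complement_def
      by (simp add: leq_dual_lattice) (simp add: dual_lattice_def)
    then show "\<exists>c. is_rel_complement (dual_lattice L) l u a c" ..
  qed
qed

section \<open>Product bilattices over relatively complemented lattices\<close>

text \<open>Keeping the maximum as a parameter \<open>one\<close> lets each instance supply its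
  known value, here \<open>\<top>\<close>; \<open>lattice_max_eq\<close> ties it to the description
  inside \<open>rel_imp\<close>.\<close>

locale relatively_complemented_lattice = distributive_lattice_algebra L
  for L :: "('a, 'm) lattice_rec_scheme" (structure) +
  fixes one :: 'a
  assumes relatively_complemented: "relatively_complemented L"
    and one_closed: "one \<in> carrier L"
    and leq_one: "x \<in> carrier L \<Longrightarrow> x \<sqsubseteq> one"
begin

lemma lattice_max_eq: "lattice_max L = one"
  unfolding lattice_max_def
  by (rule the_equality) (auto simp: one_closed leq_one intro: leq_antisym)

text \<open>The two complement equations suffice: the lower bound of the interval equals
  \<open>a \<sqinter> c\<close>, hence lies below \<open>c\<close>, and everything lies below
  \<open>one\<close>. Laws of \<open>rel_imp\<close> can then be proved by exhibiting the
  value.\<close>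

lemma rel_imp_eqI:
  assumes "a \<in> carrier L" "b \<in> carrier L" "c \<in> carrier L" "a \<sqinter> c = a \<sqinter> b" "a \<squnion> c = one"
  shows "rel_imp L a b = c"
proof -
  have c: "is_rel_complement L (a \<sqinter> b) one a c"
    using assms meet_leq2[of a c] leq_one[of c] by (simp add: is_rel_complement_def)
  show ?thesis unfolding rel_imp_def lattice_max_eq
    using is_rel_complement_unique[OF assms(1)] c by (intro the_equality) blast+
qed

lemma rel_imp_is_rel_complement:
  assumes "a \<in> carrier L" "b \<in> carrier L"
  shows "is_rel_complement L (a \<sqinter> b) one a (rel_imp L a b)"
proof -
  obtain c where c: "is_rel_complement L (a \<sqinter> b) one a c"
    using relatively_complemented assms
    unfolding relatively_complemented_def
    by (metis meet_closed meet_leq1 one_closed leq_one)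
  then have "rel_imp L a b = c"
    using assms by (intro rel_imp_eqI) (auto simp: is_rel_complement_def)
  with c show ?thesis by simp
qed

lemma rel_imp_closed: "\<lbrakk>a \<in> carrier L; b \<in> carrier L\<rbrakk> \<Longrightarrow> rel_imp L a b \<in> carrier L"
  using rel_imp_is_rel_complement[of a b] by (simp add: is_rel_complement_def)

lemma meet_rel_imp: "\<lbrakk>a \<in> carrier L; b \<in> carrier L\<rbrakk> \<Longrightarrow> a \<sqinter> rel_imp L a b = a \<sqinter> b"
  using rel_imp_is_rel_complement[of a b] by (simp add: is_rel_complement_def)

lemma join_rel_imp: "\<lbrakk>a \<in> carrier L; b \<in> carrier L\<rbrakk> \<Longrightarrow> a \<squnion> rel_imp L a b = one"
  using rel_imp_is_rel_complement[of a b] by (simp add: is_rel_complement_def)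

lemma one_join: "x \<in> carrier L \<Longrightarrow> one \<squnion> x = one"
  using leq_one[of x] by (metis join_comm leq_iff_join one_closed)

lemma one_meet: "x \<in> carrier L \<Longrightarrow> one \<sqinter> x = x"
  using leq_one[of x] by (metis leq_def meet_comm one_closed)

lemma join_one: "x \<in> carrier L \<Longrightarrow> x \<squnion> one = one"
  using leq_one[of x] by (simp add: leq_iff_join one_closed)

lemma meet_one: "x \<in> carrier L \<Longrightarrow> x \<sqinter> one = x"
  using leq_one[of x] by (simp add: leq_def)

text \<open>The relative complement is a residual: \<open>a\<close> and \<open>rel_imp L a b\<close>
  join to \<open>one\<close>, so they split \<open>c\<close> into two parts. The part in
  \<open>a\<close> lies below \<open>a \<sqinter> b\<close>, the other is below
  \<open>rel_imp L a b\<close> already.\<close>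

lemma leq_rel_imp:
  assumes "a \<in> carrier L" "b \<in> carrier L" "c \<in> carrier L" "c \<sqinter> a \<sqsubseteq> b"
  shows "c \<sqsubseteq> rel_imp L a b"
proof -
  note cl = assms(1-3) meet_closed join_closed rel_imp_closed
  have "c = c \<sqinter> (a \<squnion> rel_imp L a b)"
    using assms by (simp add: join_rel_imp meet_one)
  also have "\<dots> = (c \<sqinter> a) \<squnion> (c \<sqinter> rel_imp L a b)" by (simp add: cl meet_join_distrib)
  also have "\<dots> \<sqsubseteq> rel_imp L a b"
  proof (rule join_leqI)
    have "c \<sqinter> a \<sqsubseteq> a \<sqinter> b" using assms by (intro leq_meetI) (auto simp: cl meet_leq2)
    moreover have "a \<sqinter> b \<sqsubseteq> rel_imp L a b"
      using rel_imp_is_rel_complement[of a b] assms by (simp add: is_rel_complement_def)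
    ultimately show "c \<sqinter> a \<sqsubseteq> rel_imp L a b"
      using leq_trans[of "c \<sqinter> a" "a \<sqinter> b" "rel_imp L a b"] by (simp add: cl)
  qed (simp_all add: cl meet_leq2)
  finally show ?thesis .
qed

lemma leq_rel_imp_right: "\<lbrakk>a \<in> carrier L; b \<in> carrier L\<rbrakk> \<Longrightarrow> b \<sqsubseteq> rel_imp L a b"
  by (intro leq_rel_imp meet_leq1)

lemma rel_imp_self: "a \<in> carrier L \<Longrightarrow> rel_imp L a a = one"
  by (rule rel_imp_eqI) (auto simp: one_closed join_one meet_one meet_idem)

lemma rel_imp_one_left: "a \<in> carrier L \<Longrightarrow> rel_imp L one a = a"
  by (rule rel_imp_eqI) (auto simp: one_closed one_join)

lemma rel_imp_curry:
  assumes [simp]: "x \<in> carrier L" "y \<in> carrier L" "z \<in> carrier L"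
  shows "rel_imp L (x \<sqinter> y) z = rel_imp L x (rel_imp L y z)"
proof (rule rel_imp_eqI)
  note [simp] = meet_closed join_closed rel_imp_closed
  define q where "q = rel_imp L y z"
  define p where "p = rel_imp L x q"
  have [simp]: "q \<in> carrier L" "p \<in> carrier L" by (simp_all add: p_def q_def)
  have "(x \<sqinter> y) \<sqinter> p = y \<sqinter> (x \<sqinter> p)" by (simp add: meet_assoc meet_left_comm)
  also have "\<dots> = y \<sqinter> (x \<sqinter> q)" by (simp add: p_def meet_rel_imp)
  also have "\<dots> = x \<sqinter> (y \<sqinter> q)" by (simp add: meet_left_comm)
  also have "\<dots> = (x \<sqinter> y) \<sqinter> z" by (simp add: q_def meet_rel_imp meet_assoc)
  finally show "(x \<sqinter> y) \<sqinter> rel_imp L x (rel_imp L y z) = (x \<sqinter> y) \<sqinter> z"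
    by (simp add: p_def q_def)
  \<comment> \<open>\<open>p\<close> lies above \<open>q\<close>, which already joins with
    \<open>y\<close> to \<open>one\<close>.\<close>
  have "y \<squnion> p = one"
  proof -
    have "q \<squnion> p = p" using leq_rel_imp_right[of x q] by (simp add: leq_iff_join flip: p_def)
    then have "y \<squnion> p = (y \<squnion> q) \<squnion> p" by (simp add: join_assoc)
    then show ?thesis by (simp add: q_def join_rel_imp one_join)
  qed
  moreover have "x \<squnion> p = one" by (simp add: p_def join_rel_imp)
  moreover have "(x \<sqinter> y) \<squnion> p = (x \<squnion> p) \<sqinter> (y \<squnion> p)"
    using join_meet_distrib[of p x y] by (simp add: join_comm)
  ultimately show "(x \<sqinter> y) \<squnion> rel_imp L x (rel_imp L y z) = one"
    by (simp add: p_def q_def meet_idem one_closed)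
qed (simp_all add: meet_closed rel_imp_closed)

text \<open>Complements are symmetric: \<open>rel_imp L x y\<close> and \<open>x\<close> join to
  \<open>one\<close>, so \<open>x\<close> itself solves both equations of
  \<open>rel_imp_eqI\<close>.\<close>

lemma rel_imp_peirce:
  assumes "x \<in> carrier L" "y \<in> carrier L"
  shows "rel_imp L (rel_imp L x y) x = x"
  using assms by (intro rel_imp_eqI) (simp_all add: rel_imp_closed join_comm join_rel_imp)

text \<open>This is the first coordinate of IB5 in the product, obtained from residuation and
  \<open>meet_rel_imp\<close>.\<close>

lemma meet_rel_imp_rel_imp:
  assumes "x \<in> carrier L" "y \<in> carrier L"
  shows "x \<sqinter> rel_imp L (rel_imp L x y) (x \<sqinter> y) = x"
  using leq_rel_imp[of "rel_imp L x y" "x \<sqinter> y" x] assms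
  by (simp add: leq_def meet_closed rel_imp_closed meet_rel_imp meet_idem)

lemma rel_imp_join:
  assumes [simp]: "x \<in> carrier L" "y \<in> carrier L" "z \<in> carrier L"
  shows "rel_imp L (x \<squnion> y) z = rel_imp L x z \<sqinter> rel_imp L y z"
proof (rule rel_imp_eqI)
  note [simp] = meet_closed join_closed rel_imp_closed
  define p where "p = rel_imp L x z"
  define q where "q = rel_imp L y z"
  have [simp]: "q \<in> carrier L" "p \<in> carrier L" by (simp_all add: p_def q_def)
  \<comment> \<open>Since \<open>z\<close> is below both residuals, meeting
    \<open>x \<sqinter> z\<close> with \<open>q\<close>, or \<open>y \<sqinter> z\<close> with
    \<open>p\<close>, changes nothing.\<close>
  have zq: "z \<sqinter> q = z" using leq_rel_imp_right[of y z] by (simp add: leq_def q_def)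
  have zp: "z \<sqinter> p = z" using leq_rel_imp_right[of x z] by (simp add: leq_def p_def)
  have "x \<sqinter> (p \<sqinter> q) = x \<sqinter> z"
    by (metis \<open>p \<in> carrier L\<close> \<open>q \<in> carrier L\<close> assms meet_assoc meet_rel_imp p_def zq)
  moreover have "y \<sqinter> (p \<sqinter> q) = y \<sqinter> z"
    by (metis \<open>p \<in> carrier L\<close> \<open>q \<in> carrier L\<close> assms meet_assoc meet_comm meet_rel_imp q_def zp)
  ultimately have "(p \<sqinter> q) \<sqinter> (x \<squnion> y) = z \<sqinter> (x \<squnion> y)"
    by (simp add: meet_join_distrib meet_ac)
  then show "(x \<squnion> y) \<sqinter> (rel_imp L x z \<sqinter> rel_imp L y z) = (x \<squnion> y) \<sqinter> z"
    by (simp add: p_def q_def meet_comm)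
  have "(x \<squnion> y) \<squnion> p = y \<squnion> (x \<squnion> p)" "(x \<squnion> y) \<squnion> q = x \<squnion> (y \<squnion> q)"
    by (simp_all add: join_assoc join_left_comm)
  then show "(x \<squnion> y) \<squnion> (rel_imp L x z \<sqinter> rel_imp L y z) = one"
    by (simp add: join_meet_distrib p_def q_def join_rel_imp join_comm one_join one_closed meet_idem)
qed (simp_all add: meet_closed join_closed rel_imp_closed)

text \<open>A map preserving meets, joins and the maximum preserves the two equations that determine
  a relative complement.\<close>

lemma rel_imp_image:
  fixes M :: "('b, 'n) lattice_rec_scheme"
  assumes M: "relatively_complemented_lattice M one'"
    and closed: "\<And>x. x \<in> carrier L \<Longrightarrow> \<phi> x \<in> carrier M"
    and meet: "\<And>x y. \<lbrakk>x \<in> carrier L; y \<in> carrier L\<rbrakk> \<Longrightarrow> \<phi> (x \<sqinter> y) = \<phi> x \<sqinter>\<^bsub>M\<^esub> \<phi> y"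
    and join: "\<And>x y. \<lbrakk>x \<in> carrier L; y \<in> carrier L\<rbrakk> \<Longrightarrow> \<phi> (x \<squnion> y) = \<phi> x \<squnion>\<^bsub>M\<^esub> \<phi> y"
    and one: "\<phi> one = one'"
    and ab: "a \<in> carrier L" "b \<in> carrier L"
  shows "rel_imp M (\<phi> a) (\<phi> b) = \<phi> (rel_imp L a b)"
  using ab
  by (intro relatively_complemented_lattice.rel_imp_eqI[OF M])
    (simp_all add: closed rel_imp_closed meet_rel_imp join_rel_imp one flip: meet join)

text \<open>Each axiom splits into a law of \<open>rel_imp\<close> or of the lattice in each
  coordinate. As the truth order is reversed in the second coordinate,
  \<open>join_eq_iff_meet_eq\<close> brings both coordinates into the same form.\<close>

lemma implicative_product_bilattice: "implicative_bilattice (product_bilattice L)"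
proof unfold_locales
qed (auto simp: product_sels k_lattice_sels leq_def nonempty meet_closed join_closed meet_ac
      join_ac meet_join_absorb join_meet_absorb rel_imp_closed join_eq_iff_meet_eq
      meet_join_distrib meet_rel_imp
      rel_imp_self rel_imp_one_left rel_imp_curry rel_imp_peirce rel_imp_join one_closed meet_one
      meet_rel_imp_rel_imp)

text \<open>For \<open>x = (a, b)\<close> the self-implication is
  \<open>(one, a \<sqinter> b)\<close>; its knowledge join with its swap is \<open>one\<close> in
  both coordinates.\<close>

lemma bilattice_top_product: "bilattice_top (product_bilattice L) = (one, one)"
  unfolding bilattice_top_def
proof (rule the_equality)
  show *: "\<forall>x\<in>carrier (product_bilattice L).
    (x \<hookrightarrow>\<^bsub>product_bilattice L\<^esub> x) \<oplus>\<^bsub>product_bilattice L\<^esub>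
      (\<sim>\<^bsub>product_bilattice L\<^esub> (x \<hookrightarrow>\<^bsub>product_bilattice L\<^esub> x)) = (one, one)"
    by (auto simp: product_sels rel_imp_self meet_closed one_join join_one)
  have "(one, one) \<in> carrier (product_bilattice L)" by (simp add: product_sels one_closed)
  then show "t = (one, one)"
    if "\<forall>x\<in>carrier (product_bilattice L).
      (x \<hookrightarrow>\<^bsub>product_bilattice L\<^esub> x) \<oplus>\<^bsub>product_bilattice L\<^esub>
        (\<sim>\<^bsub>product_bilattice L\<^esub> (x \<hookrightarrow>\<^bsub>product_bilattice L\<^esub> x)) = t" for t
    using * that by force
qed

end

section \<open>Residuated De Morgan lattices\<close>

sublocale de_morgan_lattice \<subseteq> distributive_lattice_algebra A
  by unfold_locales (rule distrib)

context de_morgan_lattice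
begin

lemma neg_meet: "\<lbrakk>x \<in> carrier A; y \<in> carrier A\<rbrakk> \<Longrightarrow> \<sim> (x \<sqinter> y) = \<sim> x \<squnion> \<sim> y"
  by (rule antitone_involution_meet) (auto intro: neg_closed neg_neg neg_antitone)

lemma neg_join: "\<lbrakk>x \<in> carrier A; y \<in> carrier A\<rbrakk> \<Longrightarrow> \<sim> (x \<squnion> y) = \<sim> x \<sqinter> \<sim> y"
  by (rule antitone_involution_join) (auto intro: neg_closed neg_neg neg_antitone)

end

context residuated_de_morgan_lattice
begin

section \<open>Implication and the elements above \<open>\<top>\<close>\<close>

lemma imp_antitone:
  "\<lbrakk>x \<in> carrier A; y \<in> carrier A; z \<in> carrier A; x \<sqsubseteq> y\<rbrakk> \<Longrightarrow> y \<hookrightarrow> z \<sqsubseteq> x \<hookrightarrow> z"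
  by (metis RD4 leq_iff_join meet_leq1 imp_closed)

lemma imp_tt_below: "\<lbrakk>x \<in> carrier A; y \<in> carrier A; \<top> \<sqsubseteq> x\<rbrakk> \<Longrightarrow> x \<hookrightarrow> y \<sqsubseteq> y"
  using imp_antitone[of \<top> x y] by (simp add: RD1 tt_closed)

text \<open>By RD2 and RD1, the antecedent \<open>x \<hookrightarrow> y\<close> of
  \<open>(x \<hookrightarrow> y) \<hookrightarrow> x\<close> may be cut down to a part of
  \<open>\<top>\<close>; antitonicity (from RD4) then gives
  \<open>x \<sqsubseteq> (x \<hookrightarrow> y) \<hookrightarrow> x\<close>. A second use of
  antitonicity turns RD3 into the claim.\<close>

lemma tt_leq_imp_self: "x \<in> carrier A \<Longrightarrow> \<top> \<sqsubseteq> x \<hookrightarrow> x"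
  unfolding leq_def
  by (metis RD1 RD2 RD3 RD4 join_meet_absorb imp_closed tt_closed meet_closed join_closed)

lemma tt_leq_mp: "\<lbrakk>x \<in> carrier A; y \<in> carrier A; \<top> \<sqsubseteq> x; \<top> \<sqsubseteq> x \<hookrightarrow> y\<rbrakk> \<Longrightarrow> \<top> \<sqsubseteq> y"
  using imp_tt_below[of x y] leq_trans[of \<top> "x \<hookrightarrow> y" y] by (simp add: tt_closed imp_closed)

lemma meet_tt_imp: "\<lbrakk>x \<in> carrier A; y \<in> carrier A\<rbrakk> \<Longrightarrow> (x \<sqinter> \<top>) \<hookrightarrow> y = x \<hookrightarrow> y"
  using RD2[of x \<top> y] by (simp add: RD1 tt_closed)

lemma leq_imp_tt:
  assumes "x \<in> carrier A" "y \<in> carrier A" "x \<sqsubseteq> y"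
  shows "\<top> \<sqsubseteq> x \<hookrightarrow> y"
  using imp_antitone[of x y y] tt_leq_imp_self[of y] leq_trans[of \<top> "y \<hookrightarrow> y" "x \<hookrightarrow> y"]
  by (simp add: assms tt_closed imp_closed)

lemma tt_leq_imp_iff:
  assumes [simp]: "x \<in> carrier A" "y \<in> carrier A"
  shows "\<top> \<sqsubseteq> x \<hookrightarrow> y \<longleftrightarrow> x \<sqinter> \<top> \<sqsubseteq> y"
proof
  note [simp] = tt_closed imp_closed meet_closed join_closed neg_closed
  assume "x \<sqinter> \<top> \<sqsubseteq> y"
  then show "\<top> \<sqsubseteq> x \<hookrightarrow> y" using leq_imp_tt[of "x \<sqinter> \<top>" y] by (simp add: meet_tt_imp)
next
  note [simp] = tt_closed imp_closed meet_closed join_closed neg_closed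
  \<comment> \<open>Cutting \<open>x\<close> down to \<open>p\<close> leaves implications from it
    unchanged. It also puts \<open>\<sim> p\<close> above \<open>\<top>\<close>, which makes the
    contrapositive conjunct in RD5 automatic.\<close>
  define p where "p = x \<sqinter> \<top>"
  have [simp]: "p \<in> carrier A" by (simp add: p_def)
  assume "\<top> \<sqsubseteq> x \<hookrightarrow> y"
  then have 1: "\<top> \<sqsubseteq> p \<hookrightarrow> y" by (simp add: meet_tt_imp p_def)
  have "\<top> \<sqsubseteq> \<sim> p" using neg_antitone[of p \<top>] by (simp add: p_def meet_leq2 RD0[symmetric])
  moreover have "\<sim> y \<sqinter> \<top> \<sqsubseteq> \<top>" by (simp add: meet_leq2)
  ultimately have "\<sim> y \<sqinter> \<top> \<sqsubseteq> \<sim> p" using leq_trans[of "\<sim> y \<sqinter> \<top>" \<top> "\<sim> p"] by simp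
  then have 2: "\<top> \<sqsubseteq> \<sim> y \<hookrightarrow> \<sim> p"
    using leq_imp_tt[of "\<sim> y \<sqinter> \<top>" "\<sim> p"] by (simp add: meet_tt_imp)
  \<comment> \<open>\<open>s\<close> is the antecedent in RD5 for \<open>p\<close> and
    \<open>y\<close>. Once it lies above \<open>\<top>\<close>, it can be discharged.\<close>
  define s where "s = (p \<hookrightarrow> y) \<sqinter> (\<sim> y \<hookrightarrow> \<sim> p)"
  have "\<top> \<sqsubseteq> s" unfolding s_def using 1 2 by (intro leq_meetI) simp_all
  then have "s \<hookrightarrow> y \<sqsubseteq> y" by (intro imp_tt_below) (simp_all add: s_def)
  moreover have "p \<sqsubseteq> s \<hookrightarrow> y" using RD5[of p y] by (simp add: leq_def s_def)
  ultimately have "p \<sqsubseteq> y" using leq_trans[of p "s \<hookrightarrow> y" y] by (simp add: s_def)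
  then show "x \<sqinter> \<top> \<sqsubseteq> y" by (simp add: p_def)
qed

lemma residuation:
  assumes "x \<in> carrier A" "y \<in> carrier A" "z \<in> carrier A"
  shows "z \<sqinter> \<top> \<sqsubseteq> x \<hookrightarrow> y \<longleftrightarrow> (z \<sqinter> x) \<sqinter> \<top> \<sqsubseteq> y"
  using assms by (simp add: tt_leq_imp_iff[symmetric] imp_closed meet_closed RD2)

text \<open>For the join \<open>q\<close> in question, \<open>q \<hookrightarrow> y \<sqsubseteq> x
  \<hookrightarrow> y \<sqsubseteq> q\<close>, so the premise of Peirce's law for \<open>q\<close>
  and \<open>y\<close> holds and modus ponens gives \<open>q\<close>.\<close>

lemma tt_leq_join_imp:
  assumes [simp]: "x \<in> carrier A" "y \<in> carrier A"
  shows "\<top> \<sqsubseteq> x \<squnion> (x \<hookrightarrow> y)"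
proof -
  note [simp] = tt_closed imp_closed meet_closed join_closed
  define q where "q = x \<squnion> (x \<hookrightarrow> y)"
  have [simp]: "q \<in> carrier A" by (simp add: q_def)
  have "q \<hookrightarrow> y \<sqsubseteq> x \<hookrightarrow> y" by (intro imp_antitone) (simp_all add: q_def leq_join1)
  also have "x \<hookrightarrow> y \<sqsubseteq> q" by (simp add: q_def leq_join2)
  finally (leq_trans[rotated 3]) have "q \<hookrightarrow> y \<sqsubseteq> q" by simp
  then have "\<top> \<sqsubseteq> (q \<hookrightarrow> y) \<hookrightarrow> q" by (simp add: leq_imp_tt)
  then have "\<top> \<sqsubseteq> q" using RD3[of q y] by (intro tt_leq_mp[of "(q \<hookrightarrow> y) \<hookrightarrow> q" q]) (simp_all add: leq_def)
  then show ?thesis by (simp add: q_def)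
qed

text \<open>By RD6 both elements have the same implications. Taking each of them as consequent and
  applying \<open>tt_leq_imp_iff\<close> gives the two inequalities.\<close>

lemma neg_imp_meet_tt:
  assumes [simp]: "x \<in> carrier A" "y \<in> carrier A"
  shows "\<sim> (x \<hookrightarrow> y) \<sqinter> \<top> = x \<sqinter> \<sim> y \<sqinter> \<top>"
proof -
  note [simp] = tt_closed imp_closed meet_closed join_closed neg_closed
  define u v where "u = \<sim> (x \<hookrightarrow> y)" and "v = x \<sqinter> \<sim> y"
  have [simp]: "u \<in> carrier A" "v \<in> carrier A" by (simp_all add: u_def v_def)
  have "z \<in> carrier A \<Longrightarrow> u \<hookrightarrow> z = v \<hookrightarrow> z" for z by (simp add: u_def v_def RD6)
  then have "v \<sqinter> \<top> \<sqsubseteq> u" "u \<sqinter> \<top> \<sqsubseteq> v"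
    using tt_leq_imp_self[of u] tt_leq_imp_self[of v] by (simp_all flip: tt_leq_imp_iff)
  then have "u \<sqinter> \<top> = v \<sqinter> \<top>"
    by (intro leq_antisym leq_meetI) (simp_all add: meet_leq2)
  then show ?thesis by (simp add: u_def v_def)
qed

section \<open>The parts below and above \<open>\<top>\<close>\<close>

lemma minus_sels:
  "carrier (minus_part A) = {a \<in> carrier A. a \<sqsubseteq> \<top>}" "meet (minus_part A) = meet A"
  "join (minus_part A) = join A"
  "leq (minus_part A) = leq A"
  by (auto simp: minus_part_def leq_def fun_eq_iff)

lemma plus_sels:
  "carrier (plus_part A) = {a \<in> carrier A. \<top> \<sqsubseteq> a}" "meet (plus_part A) = meet A"
  "join (plus_part A) = join A"
  "leq (plus_part A) = leq A"
  by (auto simp: plus_part_def leq_def fun_eq_iff)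

lemma neg_tt_leq: "\<lbrakk>x \<in> carrier A; x \<sqsubseteq> \<top>\<rbrakk> \<Longrightarrow> \<top> \<sqsubseteq> \<sim> x"
  using neg_antitone[of x \<top>] by (simp add: tt_closed RD0[symmetric])

lemma neg_leq_tt: "\<lbrakk>x \<in> carrier A; \<top> \<sqsubseteq> x\<rbrakk> \<Longrightarrow> \<sim> x \<sqsubseteq> \<top>"
  using neg_antitone[of \<top> x] by (simp add: tt_closed RD0[symmetric])

lemma dually_isomorphic_minus_plus: "dually_isomorphic (minus_part A) (plus_part A)"
  unfolding dually_isomorphic_def
proof (intro exI conjI)
  show "bij_betw (neg A) (carrier (minus_part A)) (carrier (plus_part A))"
    by (rule bij_betwI[of _ _ _ "neg A"])
      (auto simp: minus_sels plus_sels neg_closed neg_neg neg_tt_leq neg_leq_tt)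
qed (auto simp: minus_sels plus_sels neg_meet neg_join)

lemma distributive_minus_part: "distributive_lattice_algebra (minus_part A)"
proof unfold_locales
  show "carrier (minus_part A) \<noteq> {}" using tt_closed leq_refl by (auto simp: minus_sels)
  fix x y assume xy: "x \<in> carrier (minus_part A)" "y \<in> carrier (minus_part A)"
  then have "x \<sqinter> y \<sqsubseteq> \<top>"
    using leq_trans[of "x \<sqinter> y" x \<top>] by (simp add: minus_sels meet_closed tt_closed meet_leq1)
  then show "x \<sqinter>\<^bsub>minus_part A\<^esub> y \<in> carrier (minus_part A)"
    using xy by (simp add: minus_sels meet_closed)
qed (auto simp: minus_sels join_leqI meet_ac join_ac tt_closed meet_closed join_closed
    meet_join_absorb join_meet_absorb distrib)

lemma distributive_plus_part: "distributive_lattice_algebra (plus_part A)"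
proof unfold_locales
  show "carrier (plus_part A) \<noteq> {}" using tt_closed leq_refl by (auto simp: plus_sels)
  fix x y assume xy: "x \<in> carrier (plus_part A)" "y \<in> carrier (plus_part A)"
  then have "\<top> \<sqsubseteq> x \<squnion> y"
    using leq_trans[of \<top> x "x \<squnion> y"] by (simp add: plus_sels join_closed tt_closed leq_join1)
  then show "x \<squnion>\<^bsub>plus_part A\<^esub> y \<in> carrier (plus_part A)"
    using xy by (simp add: plus_sels join_closed)
qed (auto simp: plus_sels leq_meetI meet_ac join_ac tt_closed meet_closed join_closed
    meet_join_absorb join_meet_absorb distrib)

text \<open>Residuation in both directions: for \<open>x \<hookrightarrow> y\<close> itself it gives
  \<open>v \<sqsubseteq> y\<close>, and for \<open>y\<close> it gives
  \<open>y \<sqinter> \<top> \<sqsubseteq> x \<hookrightarrow> y\<close>.\<close>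

lemma meet_imp_meet_tt:
  assumes [simp]: "x \<in> carrier A" "y \<in> carrier A"
  shows "x \<sqinter> ((x \<hookrightarrow> y) \<sqinter> \<top>) = x \<sqinter> y \<sqinter> \<top>"
proof -
  note [simp] = tt_closed imp_closed meet_closed join_closed
  define p where "p = x \<hookrightarrow> y"
  define v where "v = (p \<sqinter> x) \<sqinter> \<top>"
  define w where "w = (y \<sqinter> x) \<sqinter> \<top>"
  have [simp]: "p \<in> carrier A" "v \<in> carrier A" "w \<in> carrier A"
    by (simp_all add: p_def v_def w_def)
  have "v \<sqsubseteq> y" using residuation[of x y p] by (simp add: p_def v_def meet_leq1)
  moreover have "v \<sqsubseteq> x" "v \<sqsubseteq> \<top>"
    using leq_trans[of v "p \<sqinter> x" x] by (simp_all add: v_def meet_leq1 meet_leq2)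
  ultimately have 1: "v \<sqsubseteq> w" by (auto simp: w_def intro!: leq_meetI)
  have "y \<sqinter> \<top> \<sqsubseteq> p"
    using residuation[of x y y] leq_trans[of w "y \<sqinter> x" y]
    by (simp add: p_def w_def meet_leq1)
  moreover have "w \<sqsubseteq> y" "w \<sqsubseteq> x"
    using leq_trans[of w "y \<sqinter> x" x] leq_trans[of w "y \<sqinter> x" y]
    by (simp_all add: w_def meet_leq1 meet_leq2)
  moreover have "w \<sqsubseteq> \<top>" by (simp add: w_def meet_leq2)
  moreover from calculation have "w \<sqsubseteq> p"
    by (intro leq_trans[of w "y \<sqinter> \<top>" p] leq_meetI) simp_all
  ultimately have "w \<sqsubseteq> v" by (auto simp: v_def intro!: leq_meetI)
  with 1 have "v = w" by (intro leq_antisym) simp_all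
  then show ?thesis by (simp add: v_def w_def p_def meet_ac)
qed

lemma join_imp_meet_tt:
  assumes [simp]: "x \<in> carrier A" "y \<in> carrier A"
  shows "(x \<sqinter> \<top>) \<squnion> ((x \<hookrightarrow> y) \<sqinter> \<top>) = \<top>"
proof -
  note [simp] = tt_closed imp_closed meet_closed join_closed
  have "(x \<sqinter> \<top>) \<squnion> ((x \<hookrightarrow> y) \<sqinter> \<top>) = \<top> \<sqinter> (x \<squnion> (x \<hookrightarrow> y))"
    by (simp add: distrib meet_comm)
  also have "\<dots> = \<top>" using tt_leq_join_imp[of x y] by (simp add: leq_def)
  finally show ?thesis .
qed

lemma relatively_complemented_minus: "relatively_complemented (minus_part A)"
  unfolding relatively_complemented_def
proof (intro conjI ballI impI)
  note [simp] = tt_closed imp_closed meet_closed join_closed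
  show "lattice_algebra (minus_part A)"
    using distributive_minus_part by (rule distributive_lattice_algebra.axioms)
  fix l u a
  assume "l \<in> carrier (minus_part A)" "u \<in> carrier (minus_part A)" "a \<in> carrier (minus_part A)"
    and "l \<sqsubseteq>\<^bsub>minus_part A\<^esub> a \<and> a \<sqsubseteq>\<^bsub>minus_part A\<^esub> u"
  then have [simp]: "l \<in> carrier A" "u \<in> carrier A" "a \<in> carrier A"
    and leq: "l \<sqsubseteq> \<top>" "u \<sqsubseteq> \<top>" "a \<sqsubseteq> \<top>" "l \<sqsubseteq> a" "a \<sqsubseteq> u"
    by (simp_all add: minus_sels)
  \<comment> \<open>\<open>(a \<hookrightarrow> l) \<sqinter> \<top>\<close> complements
    \<open>a\<close> between \<open>l\<close> and \<open>\<top>\<close>; the meet with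
    \<open>u\<close> moves it into the smaller interval.\<close>
  define c where "c = (a \<hookrightarrow> l) \<sqinter> \<top> \<sqinter> u"
  have [simp]: "c \<in> carrier A" by (simp add: c_def)
  have "l \<sqsubseteq> u" using leq_trans[of l a u] leq by simp
  have "a \<sqinter> c = (a \<sqinter> ((a \<hookrightarrow> l) \<sqinter> \<top>)) \<sqinter> u"
    unfolding c_def by (rule meet_assoc[symmetric]) simp_all
  also have "\<dots> = (a \<sqinter> l \<sqinter> \<top>) \<sqinter> u" by (simp add: meet_imp_meet_tt)
  also have "\<dots> = l"
    using leq \<open>l \<sqsubseteq> u\<close> meet_comm[of a l] by (simp add: leq_def)
  finally have 1: "a \<sqinter> c = l" .
  have "a \<squnion> c = (a \<squnion> ((a \<hookrightarrow> l) \<sqinter> \<top>)) \<sqinter> (a \<squnion> u)" by (simp add: c_def join_meet_distrib)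
  also have "a \<squnion> ((a \<hookrightarrow> l) \<sqinter> \<top>) = \<top>" using join_imp_meet_tt[of a l] leq by (simp add: leq_def)
  also have "a \<squnion> u = u" using leq by (simp add: leq_iff_join)
  also have "\<top> \<sqinter> u = u" using leq by (simp add: leq_def meet_comm)
  finally have 2: "a \<squnion> c = u" .
  have "c \<sqsubseteq> u" by (simp add: c_def meet_leq2)
  moreover have "l \<sqsubseteq> c" using meet_leq2[of a c] 1 by simp
  moreover have "c \<sqsubseteq> \<top>" using leq leq_trans[of c u \<top>] \<open>c \<sqsubseteq> u\<close> by simp
  ultimately show "\<exists>c. is_rel_complement (minus_part A) l u a c"
    using 1 2 by (intro exI[of _ c]) (simp add: is_rel_complement_def minus_sels)
qed

lemma relatively_complemented_plus: "relatively_complemented (plus_part A)"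
  unfolding relatively_complemented_def
proof (intro conjI ballI impI)
  show "lattice_algebra (plus_part A)"
    using distributive_plus_part by (rule distributive_lattice_algebra.axioms)
  fix l u a
  assume "l \<in> carrier (plus_part A)" "u \<in> carrier (plus_part A)" "a \<in> carrier (plus_part A)"
    and "l \<sqsubseteq>\<^bsub>plus_part A\<^esub> a \<and> a \<sqsubseteq>\<^bsub>plus_part A\<^esub> u"
  then have cl: "l \<in> carrier A" "u \<in> carrier A" "a \<in> carrier A"
    and leq: "\<top> \<sqsubseteq> l" "\<top> \<sqsubseteq> u" "\<top> \<sqsubseteq> a" "l \<sqsubseteq> a" "a \<sqsubseteq> u"
    by (simp_all add: plus_sels)
  \<comment> \<open>Negation carries the interval to one below \<open>\<top>\<close>, with its ends
    exchanged; the complement found there is negated back.\<close>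
  then obtain c where "is_rel_complement (minus_part A) (\<sim> u) (\<sim> l) (\<sim> a) c"
    using relatively_complemented_minus unfolding relatively_complemented_def
    by (force simp: minus_sels neg_closed neg_leq_tt neg_antitone)
  then have c: "c \<in> carrier A" "c \<sqsubseteq> \<top>" "\<sim> u \<sqsubseteq> c" "c \<sqsubseteq> \<sim> l" "\<sim> a \<sqinter> c = \<sim> u" "\<sim> a \<squnion> c = \<sim> l"
    by (simp_all add: is_rel_complement_def minus_sels)
  have "a \<squnion> \<sim> c = u" "a \<sqinter> \<sim> c = l"
    using c(1,5,6) cl by (metis neg_closed neg_neg neg_meet neg_join)+
  moreover have "l \<sqsubseteq> \<sim> c" "\<sim> c \<sqsubseteq> u"
    using neg_antitone[of "\<sim> u" c] neg_antitone[of c "\<sim> l"] c cl by (simp_all add: neg_closed neg_neg)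
  ultimately have "is_rel_complement (plus_part A) l u a (\<sim> c)"
    using c cl by (simp add: is_rel_complement_def plus_sels neg_closed neg_tt_leq)
  then show "\<exists>c. is_rel_complement (plus_part A) l u a c" ..
qed

lemma relatively_complemented_lattice_minus: "relatively_complemented_lattice (minus_part A) \<top>"
  by (intro relatively_complemented_lattice.intro relatively_complemented_lattice_axioms.intro
      distributive_minus_part relatively_complemented_minus)
    (simp_all add: minus_sels tt_closed leq_refl)

lemma relatively_complemented_lattice_dual_plus:
  "relatively_complemented_lattice (dual_lattice (plus_part A)) \<top>"
proof -
  interpret plus: distributive_lattice_algebra "plus_part A" by (rule distributive_plus_part)
  show ?thesis
    by (intro relatively_complemented_lattice.intro relatively_complemented_lattice_axioms.intro
        plus.distributive_dual_lattice relatively_complemented_dual_lattice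
        distributive_plus_part relatively_complemented_plus)
      (auto simp: dual_lattice_def[of "plus_part A"] plus_sels leq_def tt_closed join_idem
        join_eq_iff_meet_eq meet_comm[of _ \<top>] meet_idem)
qed

text \<open>This makes the first coordinate of the canonical map respect implication, for arbitrary
  \<open>x\<close> and \<open>y\<close> of \<open>A\<close>.\<close>

lemma rel_imp_minus:
  assumes [simp]: "x \<in> carrier A" "y \<in> carrier A"
  shows "rel_imp (minus_part A) (x \<sqinter> \<top>) (y \<sqinter> \<top>) = (x \<hookrightarrow> y) \<sqinter> \<top>"
proof -
  interpret minus: relatively_complemented_lattice "minus_part A" \<top>
    by (rule relatively_complemented_lattice_minus)
  note [simp] = tt_closed imp_closed meet_closed
  have "(x \<sqinter> \<top>) \<sqinter> ((x \<hookrightarrow> y) \<sqinter> \<top>) = x \<sqinter> ((x \<hookrightarrow> y) \<sqinter> \<top>)" by (simp add: meet_ac)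
  also have "\<dots> = x \<sqinter> y \<sqinter> \<top>" by (simp add: meet_imp_meet_tt)
  also have "\<dots> = (x \<sqinter> \<top>) \<sqinter> (y \<sqinter> \<top>)" by (simp add: meet_ac)
  finally show ?thesis
    by (intro minus.rel_imp_eqI) (simp_all add: minus_sels meet_leq2 join_imp_meet_tt)
qed

text \<open>Both embeddings of the theorem are instances: \<open>\<phi>\<close> is the identity for \<open>minus_bilattice A\<close>
  and the negation for \<open>plus_bilattice A\<close>.\<close>

lemma embedding_product_bilattice:
  fixes M :: "('b, 'n) lattice_rec_scheme"
  assumes M: "relatively_complemented_lattice M one'"
    and closed: "\<And>x. x \<in> carrier (minus_part A) \<Longrightarrow> \<phi> x \<in> carrier M"
    and meet: "\<And>x y. \<lbrakk>x \<in> carrier (minus_part A); y \<in> carrier (minus_part A)\<rbrakk>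
      \<Longrightarrow> \<phi> (x \<sqinter> y) = \<phi> x \<sqinter>\<^bsub>M\<^esub> \<phi> y"
    and join: "\<And>x y. \<lbrakk>x \<in> carrier (minus_part A); y \<in> carrier (minus_part A)\<rbrakk>
      \<Longrightarrow> \<phi> (x \<squnion> y) = \<phi> x \<squnion>\<^bsub>M\<^esub> \<phi> y"
    and one: "\<phi> \<top> = one'"
    and inj: "inj_on \<phi> (carrier (minus_part A))"
  shows "residuated_bilattice_embedding A (product_bilattice M)
    (\<lambda>a. map_prod \<phi> \<phi> (canonical_map A a))"
proof -
  interpret minus: relatively_complemented_lattice "minus_part A" \<top>
    by (rule relatively_complemented_lattice_minus)
  interpret M: relatively_complemented_lattice M one' by (rule M)
  note [simp] = tt_closed imp_closed meet_closed join_closed neg_closed neg_neg meet_leq2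
  let ?h = "\<lambda>a. map_prod \<phi> \<phi> (canonical_map A a)"
  have minus [simp]: "x \<sqinter> \<top> \<in> carrier (minus_part A)" if "x \<in> carrier A" for x
    using that by (simp add: minus_sels)
  have h: "?h x = (\<phi> (x \<sqinter> \<top>), \<phi> (\<sim> x \<sqinter> \<top>))" for x by (simp add: canonical_map_def)
  have meet_tt: "(x \<sqinter> y) \<sqinter> \<top> = (x \<sqinter> \<top>) \<sqinter> (y \<sqinter> \<top>)" if "x \<in> carrier A" "y \<in> carrier A" for x y
    using that by (simp add: meet_ac)
  have join_tt: "(x \<squnion> y) \<sqinter> \<top> = (x \<sqinter> \<top>) \<squnion> (y \<sqinter> \<top>)" if "x \<in> carrier A" "y \<in> carrier A" for x y
    using that distrib[of \<top> x y] by (simp add: meet_comm)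
  have imp: "rel_imp M (\<phi> (x \<sqinter> \<top>)) (\<phi> (y \<sqinter> \<top>)) = \<phi> ((x \<hookrightarrow> y) \<sqinter> \<top>)"
    if "x \<in> carrier A" "y \<in> carrier A" for x y
  proof -
    have "rel_imp M (\<phi> (x \<sqinter> \<top>)) (\<phi> (y \<sqinter> \<top>)) =
        \<phi> (rel_imp (minus_part A) (x \<sqinter> \<top>) (y \<sqinter> \<top>))"
      by (rule minus.rel_imp_image[OF M closed])
        (auto simp only: minus_sels(2,3) meet join one that minus)
    with that show ?thesis by (simp only: rel_imp_minus)
  qed
  have "residuated_bilattice_hom A (product_bilattice M) ?h"
    unfolding residuated_bilattice_hom_def
  proof (intro conjI ballI)
    show "?h \<in> carrier A \<rightarrow> carrier (product_bilattice M)"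
      by (simp add: h product_sels closed)
    show "?h \<top> = bilattice_top (product_bilattice M)"
      by (simp add: h M.bilattice_top_product one meet_idem flip: RD0)
    fix x assume [simp]: "x \<in> carrier A"
    show "?h (\<sim> x) = \<sim>\<^bsub>product_bilattice M\<^esub> (?h x)" by (simp add: h product_sels)
    fix y assume [simp]: "y \<in> carrier A"
    show "?h (x \<sqinter> y) = ?h x \<sqinter>\<^bsub>product_bilattice M\<^esub> ?h y"
      "?h (x \<squnion> y) = ?h x \<squnion>\<^bsub>product_bilattice M\<^esub> ?h y"
      by (simp_all add: h product_sels neg_meet neg_join meet_tt join_tt meet join)
    show "?h (x \<hookrightarrow> y) = ?h x \<hookrightarrow>\<^bsub>product_bilattice M\<^esub> ?h y"
      by (simp add: h product_sels neg_imp_meet_tt meet_tt meet imp)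
  qed
  moreover have "inj_on ?h (carrier A)"
  proof (rule inj_onI)
    fix x y assume [simp]: "x \<in> carrier A" "y \<in> carrier A" and "?h x = ?h y"
    then have 1: "x \<sqinter> \<top> = y \<sqinter> \<top>" and 2: "\<sim> x \<sqinter> \<top> = \<sim> y \<sqinter> \<top>"
      by (simp_all add: h inj_on_eq_iff[OF inj])
    \<comment> \<open>Negating the second coordinates turns meets with \<open>\<top>\<close> into
      joins with \<open>\<top>\<close>, so that cancellation applies.\<close>
    from arg_cong[OF 2, of "neg A"] have "x \<squnion> \<top> = y \<squnion> \<top>"
      by (simp add: neg_meet flip: RD0)
    with 1 show "x = y" by (intro meet_join_cancel[of x y \<top>]) simp_all
  qed
  ultimately show ?thesis by (simp add: residuated_bilattice_embedding_def)
qed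

lemma embedding_minus_bilattice:
  "residuated_bilattice_embedding A (minus_bilattice A) (canonical_map A)"
proof -
  have "residuated_bilattice_embedding A (minus_bilattice A)
      (\<lambda>a. map_prod (\<lambda>x. x) (\<lambda>x. x) (canonical_map A a))"
    unfolding minus_bilattice_def
    by (rule embedding_product_bilattice[OF relatively_complemented_lattice_minus])
      (simp_all add: minus_sels(2,3))
  then show ?thesis by (simp add: map_prod_def split_def)
qed

text \<open>Explicitly, \<open>a\<close> goes to the pair of
  \<open>\<sim> a \<squnion> \<top>\<close> and \<open>a \<squnion> \<top>\<close>.\<close>

lemma embedding_plus_bilattice:
  "residuated_bilattice_embedding A (plus_bilattice A)
    (\<lambda>a. map_prod (neg A) (neg A) (canonical_map A a))"
  unfolding plus_bilattice_def
proof (rule embedding_product_bilattice[OF relatively_complemented_lattice_dual_plus])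
  show "inj_on (neg A) (carrier (minus_part A))"
    by (rule inj_on_inverseI[of _ "neg A"]) (simp add: minus_sels neg_neg)
qed (simp_all add: minus_sels plus_sels dual_lattice_def neg_closed neg_tt_leq neg_meet neg_join
    flip: RD0)

end

section \<open>Implicative bilattices\<close>

context bilattice
begin

lemmas kmeet_closed = knowledge.meet_closed[unfolded k_lattice_sels]
lemmas kjoin_closed = knowledge.join_closed[unfolded k_lattice_sels]
lemmas kmeet_comm = knowledge.meet_comm[unfolded k_lattice_sels]
lemmas kjoin_comm = knowledge.join_comm[unfolded k_lattice_sels]

lemma neg_meet: "\<lbrakk>x \<in> carrier B; y \<in> carrier B\<rbrakk> \<Longrightarrow> \<sim> (x \<sqinter> y) = \<sim> x \<squnion> \<sim> y"
  by (rule antitone_involution_meet) (auto intro: neg_closed neg_neg neg_antitone)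

lemma neg_join: "\<lbrakk>x \<in> carrier B; y \<in> carrier B\<rbrakk> \<Longrightarrow> \<sim> (x \<squnion> y) = \<sim> x \<sqinter> \<sim> y"
  by (rule antitone_involution_join) (auto intro: neg_closed neg_neg neg_antitone)

lemma neg_kmeet: "\<lbrakk>x \<in> carrier B; y \<in> carrier B\<rbrakk> \<Longrightarrow> \<sim> (x \<otimes> y) = \<sim> x \<otimes> \<sim> y"
  using knowledge.monotone_involution_meet[of "neg B" x y]
  by (simp add: k_lattice_sels neg_closed neg_neg neg_k_mono)

lemma neg_kjoin: "\<lbrakk>x \<in> carrier B; y \<in> carrier B\<rbrakk> \<Longrightarrow> \<sim> (x \<oplus> y) = \<sim> x \<oplus> \<sim> y"
  using knowledge.monotone_involution_join[of "neg B" x y]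
  by (simp add: k_lattice_sels neg_closed neg_neg neg_k_mono)

lemmas closed = meet_closed join_closed kmeet_closed kjoin_closed neg_closed

end

context implicative_bilattice
begin

text \<open>By IB1 these are exactly the values of \<open>x \<hookrightarrow> x\<close>, and each is
  a left unit for implication. They play the role of the elements above \<open>\<top>\<close> in a
  residuated De Morgan lattice.\<close>

definition designated :: "'a \<Rightarrow> bool"
  where "designated z \<longleftrightarrow> z \<in> carrier B \<and> z \<hookrightarrow> z = z"

lemma designated_closed: "designated z \<Longrightarrow> z \<in> carrier B"
  by (simp add: designated_def)

lemma designated_imp: "\<lbrakk>designated e; y \<in> carrier B\<rbrakk> \<Longrightarrow> e \<hookrightarrow> y = y"
  using IB1[of e y] by (simp add: designated_def)

lemma designated_imp_self: "x \<in> carrier B \<Longrightarrow> designated (x \<hookrightarrow> x)"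
  by (simp add: designated_def imp_closed IB1)

lemma imp_exchange:
  "\<lbrakk>x \<in> carrier B; y \<in> carrier B; z \<in> carrier B\<rbrakk> \<Longrightarrow> x \<hookrightarrow> (y \<hookrightarrow> z) = y \<hookrightarrow> (x \<hookrightarrow> z)"
  by (simp add: IB2_meet meet_comm)

text \<open>Since \<open>e \<hookrightarrow> y = y\<close>, IB3 collapses to
  \<open>(y \<hookrightarrow> e) \<hookrightarrow> e = e\<close>; exchanging antecedents then shows
  that \<open>y \<hookrightarrow> e\<close> is its own self-implication.\<close>

lemma designated_imp_right:
  assumes e: "designated e" and y: "y \<in> carrier B"
  shows "designated (y \<hookrightarrow> e)"
proof -
  have [simp]: "e \<in> carrier B" using e by (rule designated_closed)
  have "(y \<hookrightarrow> e) \<hookrightarrow> e = e"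
    using IB3[of e y] e y by (simp add: designated_imp imp_closed)
  moreover have "(y \<hookrightarrow> e) \<hookrightarrow> (y \<hookrightarrow> e) = y \<hookrightarrow> ((y \<hookrightarrow> e) \<hookrightarrow> e)"
    using y by (intro imp_exchange) (simp_all add: imp_closed)
  ultimately show ?thesis using y by (simp add: designated_def imp_closed)
qed

lemma imp_antitone:
  "\<lbrakk>x \<in> carrier B; y \<in> carrier B; z \<in> carrier B; x \<sqsubseteq> y\<rbrakk> \<Longrightarrow> y \<hookrightarrow> z \<sqsubseteq> x \<hookrightarrow> z"
  by (metis IB4_join leq_iff_join meet_leq1 imp_closed)

lemma leq_kmeet:
  "\<lbrakk>x \<in> carrier B; y \<in> carrier B; designated (x \<hookrightarrow> y)\<rbrakk> \<Longrightarrow> x \<sqsubseteq> x \<otimes> y"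
  using IB5[of x y] by (simp add: leq_def designated_imp closed)

text \<open>IB5 is used twice, with \<open>x \<otimes> y\<close> in between: directly it gives
  \<open>x \<sqsubseteq> x \<otimes> y\<close>, and for the negations it gives
  \<open>x \<otimes> y \<sqsubseteq> y\<close>.\<close>

lemma designated_leqI:
  assumes "x \<in> carrier B" "y \<in> carrier B" "designated (x \<hookrightarrow> y)" "designated (\<sim> y \<hookrightarrow> \<sim> x)"
  shows "x \<sqsubseteq> y"
proof -
  have "\<sim> y \<sqsubseteq> \<sim> (x \<otimes> y)"
    using leq_kmeet[of "\<sim> y" "\<sim> x"] assms by (simp add: neg_kmeet kmeet_comm closed)
  then have "x \<otimes> y \<sqsubseteq> y"
    using neg_antitone[of "\<sim> y" "\<sim> (x \<otimes> y)"] assms by (simp add: neg_neg closed)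
  with leq_kmeet[of x y] show ?thesis using assms leq_trans[of x "x \<otimes> y" y] by (simp add: closed)
qed

lemma neg_imp_imp:
  "\<lbrakk>x \<in> carrier B; y \<in> carrier B; z \<in> carrier B\<rbrakk> \<Longrightarrow> \<sim> (x \<hookrightarrow> y) \<hookrightarrow> z = x \<hookrightarrow> (\<sim> y \<hookrightarrow> z)"
  by (simp add: IB6 IB2_meet closed)

text \<open>Exchange and IB6 bring both premises of \<open>designated_leqI\<close> to implications
  from \<open>z\<close> with a self-implication as consequent.\<close>

lemma leq_imp:
  assumes "w \<in> carrier B" "z \<in> carrier B"
  shows "w \<sqsubseteq> z \<hookrightarrow> w"
proof (rule designated_leqI)
  show "designated (w \<hookrightarrow> (z \<hookrightarrow> w))"
    using assms imp_exchange[of w z w] by (simp add: designated_imp_right designated_imp_self)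
  show "designated (\<sim> (z \<hookrightarrow> w) \<hookrightarrow> \<sim> w)"
    using assms by (simp add: neg_imp_imp closed designated_imp_right designated_imp_self)
qed (use assms in \<open>simp_all add: imp_closed\<close>)

lemma designated_upward:
  assumes e: "designated e" and z: "z \<in> carrier B" and "e \<sqsubseteq> z"
  shows "designated z"
proof -
  have "z \<hookrightarrow> z \<sqsubseteq> z"
    using assms imp_antitone[of e z z] by (simp add: designated_closed designated_imp)
  then have "z \<hookrightarrow> z = z" using leq_imp[of z z] z by (intro leq_antisym) (simp_all add: imp_closed)
  then show ?thesis using z by (simp add: designated_def)
qed

text \<open>\<open>u \<hookrightarrow> (v \<hookrightarrow> w)\<close> is designated and equals
  \<open>(u \<otimes> v) \<hookrightarrow> w\<close> by IB2; as
  \<open>u \<sqsubseteq> u \<otimes> v\<close>, antitonicity passes to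
  \<open>u \<hookrightarrow> w\<close>.\<close>

lemma designated_trans:
  assumes "u \<in> carrier B" "v \<in> carrier B" "w \<in> carrier B"
    and "designated (u \<hookrightarrow> v)" "designated (v \<hookrightarrow> w)"
  shows "designated (u \<hookrightarrow> w)"
proof (rule designated_upward)
  have "u \<hookrightarrow> (v \<hookrightarrow> w) = (u \<otimes> v) \<hookrightarrow> w" using assms by (simp add: IB2_meet IB2_kmeet)
  then show "designated ((u \<otimes> v) \<hookrightarrow> w)"
    using assms designated_imp_right[of "v \<hookrightarrow> w" u] by simp
  show "(u \<otimes> v) \<hookrightarrow> w \<sqsubseteq> u \<hookrightarrow> w"
    using assms by (intro imp_antitone leq_kmeet) (simp_all add: closed)
qed (use assms in \<open>simp add: imp_closed\<close>)

lemma designated_mp: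
  assumes "x \<in> carrier B" "y \<in> carrier B"
  shows "designated (x \<hookrightarrow> ((x \<hookrightarrow> y) \<hookrightarrow> y))"
  using assms imp_exchange[of x "x \<hookrightarrow> y" y] by (simp add: designated_imp_self imp_closed)

lemma designated_imp_mono:
  assumes [simp]: "x \<in> carrier B" "u \<in> carrier B" "v \<in> carrier B" and "designated (u \<hookrightarrow> v)"
  shows "designated ((x \<hookrightarrow> u) \<hookrightarrow> (x \<hookrightarrow> v))"
proof -
  note [simp] = closed imp_closed
  have "designated (((x \<hookrightarrow> u) \<sqinter> x) \<hookrightarrow> u)"
    using designated_imp_self[of "x \<hookrightarrow> u"] by (simp flip: IB2_meet)
  then have "designated (((x \<hookrightarrow> u) \<sqinter> x) \<hookrightarrow> v)"
    by (rule designated_trans[rotated 3]) (simp_all add: assms)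
  then show ?thesis by (simp add: IB2_meet)
qed

text \<open>A designated implication, weaker than \<open>u \<sqsubseteq> v\<close>, already reverses
  the truth order of implications. IB6 rewrites the negated half so that it too follows by
  transitivity through \<open>v\<close>.\<close>

lemma designated_imp_antimono:
  assumes [simp]: "u \<in> carrier B" "v \<in> carrier B" "z \<in> carrier B" and uv: "designated (u \<hookrightarrow> v)"
  shows "v \<hookrightarrow> z \<sqsubseteq> u \<hookrightarrow> z"
proof (rule designated_leqI)
  note [simp] = closed imp_closed
  have "designated (u \<hookrightarrow> ((v \<hookrightarrow> z) \<hookrightarrow> z))"
    by (rule designated_trans[of _ v]) (simp_all add: uv designated_mp)
  then show "designated ((v \<hookrightarrow> z) \<hookrightarrow> (u \<hookrightarrow> z))" by (simp add: imp_exchange)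
  have "designated (v \<hookrightarrow> (\<sim> z \<hookrightarrow> \<sim> (v \<hookrightarrow> z)))"
    using designated_imp_self[of "\<sim> (v \<hookrightarrow> z)"] by (simp add: neg_imp_imp)
  then have "designated (u \<hookrightarrow> (\<sim> z \<hookrightarrow> \<sim> (v \<hookrightarrow> z)))"
    by (rule designated_trans[rotated 4]) (simp_all add: uv)
  then show "designated (\<sim> (u \<hookrightarrow> z) \<hookrightarrow> \<sim> (v \<hookrightarrow> z))" by (simp add: neg_imp_imp)
qed (simp_all add: imp_closed)

section \<open>Equivalence of elements with the same implications\<close>

definition imp_equiv :: "'a \<Rightarrow> 'a \<Rightarrow> bool"
  where "imp_equiv x y \<longleftrightarrow> (\<forall>z\<in>carrier B. x \<hookrightarrow> z = y \<hookrightarrow> z)"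

lemma imp_equivD: "\<lbrakk>imp_equiv x y; z \<in> carrier B\<rbrakk> \<Longrightarrow> x \<hookrightarrow> z = y \<hookrightarrow> z"
  by (simp add: imp_equiv_def)

lemma imp_equiv_designated:
  assumes "x \<in> carrier B" "y \<in> carrier B" "imp_equiv x y"
  shows "designated (x \<hookrightarrow> y)" "designated (y \<hookrightarrow> x)"
  using assms designated_imp_self by (metis imp_equiv_def)+

text \<open>Compatibility with the left argument is built into the relation; for the right argument,
  equivalence is first turned into designated implications in both directions.\<close>

lemma imp_equiv_imp_right:
  assumes [simp]: "x \<in> carrier B" "u \<in> carrier B" "v \<in> carrier B" and uv: "imp_equiv u v"
  shows "imp_equiv (x \<hookrightarrow> u) (x \<hookrightarrow> v)"
  unfolding imp_equiv_def
  by (intro ballI leq_antisym designated_imp_antimono designated_imp_mono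
      imp_equiv_designated[OF _ _ uv]) (simp_all add: imp_closed)

lemma imp_equiv_eqI:
  assumes "x \<in> carrier B" "y \<in> carrier B" "imp_equiv x y" "imp_equiv (\<sim> x) (\<sim> y)"
  shows "x = y"
  using assms imp_equiv_designated[of x y] imp_equiv_designated[of "\<sim> x" "\<sim> y"]
  by (intro leq_antisym designated_leqI) (simp_all add: closed)

text \<open>Every \<open>t x\<close> is a left unit for implication and is fixed by negation, so
  \<open>imp_equiv_eqI\<close> identifies any two of them.\<close>

lemma bilattice_top_eq:
  assumes [simp]: "x \<in> carrier B"
  shows "bilattice_top B = (x \<hookrightarrow> x) \<oplus> \<sim> (x \<hookrightarrow> x)"
proof -
  note [simp] = closed imp_closed
  define t where "t x = (x \<hookrightarrow> x) \<oplus> \<sim> (x \<hookrightarrow> x)" for x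
  have t_closed [simp]: "t x \<in> carrier B" if "x \<in> carrier B" for x using that by (simp add: t_def)
  have t_imp: "t x \<hookrightarrow> z = z" if [simp]: "x \<in> carrier B" "z \<in> carrier B" for x z
    using leq_imp[of z "\<sim> (x \<hookrightarrow> x)"] unfolding t_def
    by (simp add: IB1 leq_def flip: IB4_kjoin)
  have t_neg: "\<sim> (t x) = t x" if "x \<in> carrier B" for x
    using that by (simp add: t_def neg_kjoin neg_neg kjoin_comm)
  have "t x = t y" if "x \<in> carrier B" "y \<in> carrier B" for x y
    using that by (intro imp_equiv_eqI) (simp_all add: imp_equiv_def t_imp t_neg)
  then have "(THE s. \<forall>x\<in>carrier B. t x = s) = t x"
    by (intro the_equality) (metis assms)+
  then show ?thesis by (simp add: bilattice_top_def t_def)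
qed

lemma bilattice_top_closed: "bilattice_top B \<in> carrier B"
  using nonempty bilattice_top_eq by (auto simp: closed imp_closed)

lemma bilattice_top_imp:
  assumes "z \<in> carrier B"
  shows "bilattice_top B \<hookrightarrow> z = z"
  using assms leq_imp[of z "\<sim> (z \<hookrightarrow> z)"] unfolding bilattice_top_eq[OF assms]
  by (simp add: IB1 leq_def closed imp_closed flip: IB4_kjoin)

lemma designated_bilattice_top: "designated (bilattice_top B)"
  by (simp add: designated_def bilattice_top_closed bilattice_top_imp)

lemma neg_bilattice_top: "\<sim> (bilattice_top B) = bilattice_top B"
proof -
  obtain x where [simp]: "x \<in> carrier B" using nonempty by blast
  show ?thesis
    unfolding bilattice_top_eq[OF \<open>x \<in> carrier B\<close>]
    by (simp add: neg_kjoin neg_neg kjoin_comm closed imp_closed)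
qed

lemma meet_imp: "\<lbrakk>x \<in> carrier B; y \<in> carrier B; z \<in> carrier B\<rbrakk> \<Longrightarrow> (x \<sqinter> y) \<hookrightarrow> z = x \<hookrightarrow> (y \<hookrightarrow> z)"
  by (simp add: IB2_meet)

lemma kmeet_imp: "\<lbrakk>x \<in> carrier B; y \<in> carrier B; z \<in> carrier B\<rbrakk> \<Longrightarrow> (x \<otimes> y) \<hookrightarrow> z = x \<hookrightarrow> (y \<hookrightarrow> z)"
  by (simp add: IB2_meet IB2_kmeet)

lemma kjoin_imp:
  "\<lbrakk>x \<in> carrier B; y \<in> carrier B; z \<in> carrier B\<rbrakk> \<Longrightarrow> (x \<oplus> y) \<hookrightarrow> z = (x \<hookrightarrow> z) \<sqinter> (y \<hookrightarrow> z)"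
  by (simp add: IB4_kjoin)

text \<open>As antecedents, the join with the top and the top itself have no effect, so both sides
  have the implications of \<open>x\<close>. Negation fixes the top and exchanges the roles of the
  two factors, so the same holds for the negations.\<close>

lemma kmeet_split_at_top:
  assumes [simp]: "x \<in> carrier B"
  shows "(x \<sqinter> bilattice_top B) \<otimes> (x \<squnion> bilattice_top B) = x"
proof -
  note [simp] = closed imp_closed bilattice_top_closed
  have join: "(y \<squnion> bilattice_top B) \<hookrightarrow> z = z" if "y \<in> carrier B" "z \<in> carrier B" for y z
    using that leq_imp[of z y] by (simp add: IB4_join bilattice_top_imp leq_def meet_comm)
  show ?thesis
  proof (rule imp_equiv_eqI)
    show "imp_equiv ((x \<sqinter> bilattice_top B) \<otimes> (x \<squnion> bilattice_top B)) x"
      by (simp add: imp_equiv_def kmeet_imp meet_imp bilattice_top_imp join)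
    show "imp_equiv (\<sim> ((x \<sqinter> bilattice_top B) \<otimes> (x \<squnion> bilattice_top B))) (\<sim> x)"
      by (simp add: imp_equiv_def neg_kmeet neg_meet neg_join neg_bilattice_top kmeet_imp meet_imp
          bilattice_top_imp join)
  qed simp_all
qed

end

section \<open>Extending homomorphisms\<close>

locale residuated_bilattice_homomorphism =
  A: residuated_de_morgan_lattice A + B: implicative_bilattice B
  for A :: "('a, 'm) residuated_rec_scheme" and B :: "('b, 'n) bilattice_rec_scheme" +
  fixes f :: "'a \<Rightarrow> 'b"
  assumes hom: "residuated_bilattice_hom A B f"
begin

sublocale minus: relatively_complemented_lattice "minus_part A" "\<top>\<^bsub>A\<^esub>"
  by (rule A.relatively_complemented_lattice_minus)

lemma hom_closed: "x \<in> carrier A \<Longrightarrow> f x \<in> carrier B"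
  using hom by (auto simp: residuated_bilattice_hom_def)

lemma hom_ops:
  "\<lbrakk>x \<in> carrier A; y \<in> carrier A\<rbrakk> \<Longrightarrow> f (x \<sqinter>\<^bsub>A\<^esub> y) = f x \<sqinter>\<^bsub>B\<^esub> f y"
  "\<lbrakk>x \<in> carrier A; y \<in> carrier A\<rbrakk> \<Longrightarrow> f (x \<squnion>\<^bsub>A\<^esub> y) = f x \<squnion>\<^bsub>B\<^esub> f y"
  "\<lbrakk>x \<in> carrier A; y \<in> carrier A\<rbrakk> \<Longrightarrow> f (x \<hookrightarrow>\<^bsub>A\<^esub> y) = f x \<hookrightarrow>\<^bsub>B\<^esub> f y"
  "x \<in> carrier A \<Longrightarrow> f (\<sim>\<^bsub>A\<^esub> x) = \<sim>\<^bsub>B\<^esub> (f x)"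
  "f \<top>\<^bsub>A\<^esub> = bilattice_top B"
  using hom by (simp_all add: residuated_bilattice_hom_def)

lemma minus_carrier: "x \<in> carrier (minus_part A) \<Longrightarrow> x \<in> carrier A"
  by (simp add: A.minus_sels)

text \<open>\<open>\<sim> x\<close> lies above \<open>\<top>\<close>, so its image lies above a
  designated element. Hence the factor for the second coordinate disappears from antecedents in
  \<open>extension_imp\<close>.\<close>

lemma neg_hom_imp:
  assumes x: "x \<in> carrier (minus_part A)" and z: "z \<in> carrier B"
  shows "\<sim>\<^bsub>B\<^esub> (f x) \<hookrightarrow>\<^bsub>B\<^esub> z = z"
proof -
  have [simp]: "x \<in> carrier A" using x by (rule minus_carrier)
  have "\<top>\<^bsub>A\<^esub> \<sqsubseteq>\<^bsub>A\<^esub> \<sim>\<^bsub>A\<^esub> x" using x by (simp add: A.minus_sels A.neg_tt_leq)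
  then have "bilattice_top B \<sqsubseteq>\<^bsub>B\<^esub> f (\<sim>\<^bsub>A\<^esub> x)"
    unfolding leq_def by (metis \<open>x \<in> carrier A\<close> A.neg_closed A.tt_closed hom_ops(1,5))
  then show ?thesis
    using z by (intro B.designated_imp B.designated_upward[OF B.designated_bilattice_top])
      (simp_all add: hom_ops hom_closed B.neg_closed)
qed

lemma canonical_map_minus:
  assumes "a \<in> carrier (minus_part A)"
  shows "canonical_map A a = (a, \<top>\<^bsub>A\<^esub>)"
  using assms A.neg_tt_leq[of a]
  by (simp add: canonical_map_def A.minus_sels leq_def A.meet_comm A.neg_closed A.tt_closed)

lemma bilattice_extension_minus:
  assumes "bilattice_extension A B f g" "a \<in> carrier (minus_part A)"
  shows "g (a, \<top>\<^bsub>A\<^esub>) = f a"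
  using assms minus_carrier[of a]
  by (simp add: bilattice_extension_def flip: canonical_map_minus)

lemma extension_value:
  assumes g: "bilattice_extension A B f g"
    and ab: "a \<in> carrier (minus_part A)" "b \<in> carrier (minus_part A)"
  shows "g (a, b) = f a \<otimes>\<^bsub>B\<^esub> \<sim>\<^bsub>B\<^esub> (f b)"
proof -
  have "(a, b) = (a, \<top>\<^bsub>A\<^esub>) \<otimes>\<^bsub>minus_bilattice A\<^esub> (\<sim>\<^bsub>minus_bilattice A\<^esub> (b, \<top>\<^bsub>A\<^esub>))"
    using ab by (simp add: minus_bilattice_def product_sels minus.meet_one minus.one_meet)
  also have "g \<dots> = g (a, \<top>\<^bsub>A\<^esub>) \<otimes>\<^bsub>B\<^esub> g (\<sim>\<^bsub>minus_bilattice A\<^esub> (b, \<top>\<^bsub>A\<^esub>))"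
  proof -
    have "(a, \<top>\<^bsub>A\<^esub>) \<in> carrier (minus_bilattice A)"
      "\<sim>\<^bsub>minus_bilattice A\<^esub> (b, \<top>\<^bsub>A\<^esub>) \<in> carrier (minus_bilattice A)"
      using ab minus.one_closed by (simp_all add: minus_bilattice_def product_sels)
    then show ?thesis
      using g unfolding bilattice_extension_def implicative_bilattice_hom_def by blast
  qed
  also have "g (\<sim>\<^bsub>minus_bilattice A\<^esub> (b, \<top>\<^bsub>A\<^esub>)) = \<sim>\<^bsub>B\<^esub> (g (b, \<top>\<^bsub>A\<^esub>))"
  proof -
    have "(b, \<top>\<^bsub>A\<^esub>) \<in> carrier (minus_bilattice A)"
      using ab minus.one_closed by (simp add: minus_bilattice_def product_sels)
    then show ?thesis
      using g unfolding bilattice_extension_def implicative_bilattice_hom_def by blast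
  qed
  finally show ?thesis using bilattice_extension_minus[OF g] ab by simp
qed

text \<open>The restriction makes the map extensional, as \<open>bilattice_extension\<close>
  demands.\<close>

definition extension :: "'a \<times> 'a \<Rightarrow> 'b"
  where "extension = restrict (\<lambda>(a, b). f a \<otimes>\<^bsub>B\<^esub> \<sim>\<^bsub>B\<^esub> (f b)) (carrier (minus_bilattice A))"

lemma carrier_minus_bilattice:
  "carrier (minus_bilattice A) = carrier (minus_part A) \<times> carrier (minus_part A)"
  by (simp add: minus_bilattice_def product_sels)

lemma extension_closed:
  "p \<in> carrier (minus_bilattice A) \<Longrightarrow> extension p \<in> carrier B"
  by (auto simp: extension_def carrier_minus_bilattice hom_closed minus_carrier B.closed)

lemma extension_extensional: "extension \<in> extensional (carrier (minus_bilattice A))"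
  by (simp add: extension_def)

lemma extension_imp:
  assumes "a \<in> carrier (minus_part A)" "b \<in> carrier (minus_part A)" "z \<in> carrier B"
  shows "extension (a, b) \<hookrightarrow>\<^bsub>B\<^esub> z = f a \<hookrightarrow>\<^bsub>B\<^esub> z"
  using assms
  by (simp add: extension_def carrier_minus_bilattice B.kmeet_imp hom_closed minus_carrier
      B.closed neg_hom_imp)

lemma neg_extension:
  assumes "a \<in> carrier (minus_part A)" "b \<in> carrier (minus_part A)"
  shows "\<sim>\<^bsub>B\<^esub> (extension (a, b)) = extension (b, a)"
  using assms
  by (simp add: extension_def carrier_minus_bilattice B.neg_kmeet B.neg_neg B.kmeet_comm
      hom_closed minus_carrier B.closed)

lemma hom_rel_imp:
  assumes "a \<in> carrier (minus_part A)" "b \<in> carrier (minus_part A)"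
  shows "f (rel_imp (minus_part A) a b) = (f a \<hookrightarrow>\<^bsub>B\<^esub> f b) \<sqinter>\<^bsub>B\<^esub> bilattice_top B"
  using A.rel_imp_minus[of a b] assms
  by (simp add: A.minus_sels leq_def hom_ops A.imp_closed A.tt_closed)

lemma extension_hom: "implicative_bilattice_hom (minus_bilattice A) B extension"
  unfolding implicative_bilattice_hom_def
proof (intro conjI ballI)
  show "extension \<in> carrier (minus_bilattice A) \<rightarrow> carrier B"
    using extension_closed by blast
  fix p assume "p \<in> carrier (minus_bilattice A)"
  then obtain a b where p: "p = (a, b)"
    and ab [simp]: "a \<in> carrier (minus_part A)" "b \<in> carrier (minus_part A)"
    by (auto simp: carrier_minus_bilattice)
  show "extension (\<sim>\<^bsub>minus_bilattice A\<^esub> p) = \<sim>\<^bsub>B\<^esub> (extension p)"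
    by (simp add: p neg_extension) (simp add: minus_bilattice_def product_sels)
  fix q assume "q \<in> carrier (minus_bilattice A)"
  then obtain c d where q: "q = (c, d)"
    and cd [simp]: "c \<in> carrier (minus_part A)" "d \<in> carrier (minus_part A)"
    by (auto simp: carrier_minus_bilattice)
  have ops: "f (x \<sqinter>\<^bsub>minus_part A\<^esub> y) = f x \<sqinter>\<^bsub>B\<^esub> f y"
    "f (x \<squnion>\<^bsub>minus_part A\<^esub> y) = f x \<squnion>\<^bsub>B\<^esub> f y"
    if "x \<in> carrier (minus_part A)" "y \<in> carrier (minus_part A)" for x y
    using that by (simp_all add: A.minus_sels hom_ops)
  note [simp] = minus_carrier hom_closed B.closed B.imp_closed minus.meet_closed
    minus.join_closed minus.rel_imp_closed extension_closed carrier_minus_bilattice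
    A.meet_closed A.join_closed
  note sels = minus_bilattice_def product_sels
  note rules = B.imp_equiv_def extension_imp B.meet_imp B.IB4_join B.kmeet_imp B.kjoin_imp
    neg_extension B.neg_meet B.neg_join B.neg_kmeet B.neg_kjoin
  \<comment> \<open>Each equation is tested on implications, where only first coordinates matter;
    the negated half swaps coordinates and tests the second ones.\<close>
  have meet: "extension (a \<sqinter>\<^bsub>minus_part A\<^esub> c, b \<squnion>\<^bsub>minus_part A\<^esub> d) =
      extension (a, b) \<sqinter>\<^bsub>B\<^esub> extension (c, d)"
    by (rule B.imp_equiv_eqI) (simp_all add: rules ops)
  then show "extension (p \<sqinter>\<^bsub>minus_bilattice A\<^esub> q) = extension p \<sqinter>\<^bsub>B\<^esub> extension q"
    by (simp add: p q sels)
  have join: "extension (a \<squnion>\<^bsub>minus_part A\<^esub> c, b \<sqinter>\<^bsub>minus_part A\<^esub> d) =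
      extension (a, b) \<squnion>\<^bsub>B\<^esub> extension (c, d)"
    by (rule B.imp_equiv_eqI) (simp_all add: rules ops)
  then show "extension (p \<squnion>\<^bsub>minus_bilattice A\<^esub> q) = extension p \<squnion>\<^bsub>B\<^esub> extension q"
    by (simp add: p q sels)
  have kmeet: "extension (a \<sqinter>\<^bsub>minus_part A\<^esub> c, b \<sqinter>\<^bsub>minus_part A\<^esub> d) =
      extension (a, b) \<otimes>\<^bsub>B\<^esub> extension (c, d)"
    by (rule B.imp_equiv_eqI) (simp_all add: rules ops)
  then show "extension (p \<otimes>\<^bsub>minus_bilattice A\<^esub> q) = extension p \<otimes>\<^bsub>B\<^esub> extension q"
    by (simp add: p q sels)
  have kjoin: "extension (a \<squnion>\<^bsub>minus_part A\<^esub> c, b \<squnion>\<^bsub>minus_part A\<^esub> d) =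
      extension (a, b) \<oplus>\<^bsub>B\<^esub> extension (c, d)"
    by (rule B.imp_equiv_eqI) (simp_all add: rules ops)
  then show "extension (p \<oplus>\<^bsub>minus_bilattice A\<^esub> q) = extension p \<oplus>\<^bsub>B\<^esub> extension q"
    by (simp add: p q sels)
  \<comment> \<open>For \<open>\<hookrightarrow>\<close> the extension also occurs as a consequent,
    which \<open>extension_imp\<close> does not rewrite, so a congruence in the right argument is
    prepared.\<close>
  have "B.imp_equiv (f c) (extension (c, d))" by (simp add: rules)
  then have "B.imp_equiv (f a \<hookrightarrow>\<^bsub>B\<^esub> f c) (f a \<hookrightarrow>\<^bsub>B\<^esub> extension (c, d))"
    by (intro B.imp_equiv_imp_right) simp_all
  then have "(f a \<hookrightarrow>\<^bsub>B\<^esub> f c) \<hookrightarrow>\<^bsub>B\<^esub> z = (f a \<hookrightarrow>\<^bsub>B\<^esub> extension (c, d)) \<hookrightarrow>\<^bsub>B\<^esub> z"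
    if "z \<in> carrier B" for z using that by (rule B.imp_equivD)
  then have imp: "extension (rel_imp (minus_part A) a c, a \<sqinter>\<^bsub>minus_part A\<^esub> d) =
      extension (a, b) \<hookrightarrow>\<^bsub>B\<^esub> extension (c, d)"
    by (intro B.imp_equiv_eqI)
      (simp_all add: rules ops hom_rel_imp B.bilattice_top_closed B.bilattice_top_imp
        B.neg_imp_imp)
  then show "extension (p \<hookrightarrow>\<^bsub>minus_bilattice A\<^esub> q) = extension p \<hookrightarrow>\<^bsub>B\<^esub> extension q"
    by (simp add: p q sels)
qed

text \<open>Negating the image of \<open>\<sim> x \<sqinter> \<top>\<close> gives the join of
  \<open>f x\<close> with the top, so the value is the knowledge meet that
  \<open>kmeet_split_at_top\<close> recombines into \<open>f x\<close>.\<close>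

lemma extension_canonical_map:
  assumes [simp]: "x \<in> carrier A"
  shows "extension (canonical_map A x) = f x"
proof -
  note [simp] = A.neg_closed A.meet_closed A.tt_closed A.meet_leq2 hom_closed B.neg_closed
    B.bilattice_top_closed
  have "canonical_map A x \<in> carrier (minus_bilattice A)"
    by (simp add: canonical_map_def carrier_minus_bilattice A.minus_sels)
  then have "extension (canonical_map A x) =
      (f x \<sqinter>\<^bsub>B\<^esub> bilattice_top B) \<otimes>\<^bsub>B\<^esub> (f x \<squnion>\<^bsub>B\<^esub> bilattice_top B)"
    by (simp add: extension_def canonical_map_def hom_ops B.neg_meet B.neg_neg
        B.neg_bilattice_top)
  then show ?thesis by (simp add: B.kmeet_split_at_top)
qed

lemma bilattice_extension_extension: "bilattice_extension A B f extension"
  using extension_hom extension_canonical_map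
  by (auto simp: bilattice_extension_def PiE_iff extension_closed extension_extensional)

section \<open>Uniqueness and injectivity of the extension\<close>

lemma bilattice_extension_unique:
  assumes "bilattice_extension A B f g"
  shows "g = extension"
proof (rule extensionalityI[OF _ extension_extensional])
  show "g \<in> extensional (carrier (minus_bilattice A))"
    using assms by (simp add: bilattice_extension_def PiE_iff)
  show "g p = extension p" if "p \<in> carrier (minus_bilattice A)" for p
    using that extension_value[OF assms] by (auto simp: carrier_minus_bilattice extension_def)
qed

lemma bilattice_extension_inj:
  assumes g: "bilattice_extension A B f g" and inj: "inj_on f (carrier A)"
  shows "inj_on g (carrier (minus_bilattice A))"
proof (rule inj_onI)
  have ghom: "implicative_bilattice_hom (minus_bilattice A) B g"
    using g by (simp add: bilattice_extension_def)
  have first: "f a = g (a, b) \<sqinter>\<^bsub>B\<^esub> g (\<top>\<^bsub>A\<^esub>, \<top>\<^bsub>A\<^esub>)"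
    if "a \<in> carrier (minus_part A)" "b \<in> carrier (minus_part A)" for a b
  proof -
    have "f a = g (a, \<top>\<^bsub>A\<^esub>)" using bilattice_extension_minus[OF g that(1)] ..
    also have "(a, \<top>\<^bsub>A\<^esub>) = (a, b) \<sqinter>\<^bsub>minus_bilattice A\<^esub> (\<top>\<^bsub>A\<^esub>, \<top>\<^bsub>A\<^esub>)"
      using that
      by (simp add: minus_bilattice_def product_sels minus.meet_one minus.join_one)
    also have "g \<dots> = g (a, b) \<sqinter>\<^bsub>B\<^esub> g (\<top>\<^bsub>A\<^esub>, \<top>\<^bsub>A\<^esub>)"
      using ghom that minus.one_closed
      unfolding implicative_bilattice_hom_def carrier_minus_bilattice by blast
    finally show ?thesis .
  qed
  fix p q
  assume pq: "p \<in> carrier (minus_bilattice A)" "q \<in> carrier (minus_bilattice A)" "g p = g q"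
  obtain a b c d where eq: "p = (a, b)" "q = (c, d)" by (metis surj_pair)
  then have cl: "a \<in> carrier (minus_part A)" "b \<in> carrier (minus_part A)"
    "c \<in> carrier (minus_part A)" "d \<in> carrier (minus_part A)"
    using pq by (simp_all add: carrier_minus_bilattice)
  \<comment> \<open>Negation swaps the coordinates, so \<open>first\<close> recovers the second
    coordinate from the negated pair.\<close>
  have swap: "g (y, x) = \<sim>\<^bsub>B\<^esub> (g (x, y))"
    if "x \<in> carrier (minus_part A)" "y \<in> carrier (minus_part A)" for x y
  proof -
    have "(y, x) = \<sim>\<^bsub>minus_bilattice A\<^esub> (x, y)"
      by (simp add: minus_bilattice_def product_sels)
    then have "g (y, x) = g (\<sim>\<^bsub>minus_bilattice A\<^esub> (x, y))" by (rule arg_cong)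
    also have "\<dots> = \<sim>\<^bsub>B\<^esub> (g (x, y))"
      using ghom that unfolding implicative_bilattice_hom_def carrier_minus_bilattice by blast
    finally show ?thesis .
  qed
  have "f a = f c" using first[of a b] first[of c d] pq(3) cl by (simp add: eq)
  moreover have "f b = f d"
    using first[of b a] first[of d c] swap[of a b] swap[of c d] pq(3) cl by (simp add: eq)
  ultimately show "p = q" using cl by (simp add: eq inj_on_eq_iff[OF inj] minus_carrier)
qed

end

theorem theorem5p4p5:
  fixes A :: "'a residuated_rec"
  assumes "residuated_de_morgan_lattice A"
  shows
    "dually_isomorphic (minus_part A) (plus_part A)
     \<and> (relatively_complemented (minus_part A) \<and> relatively_complemented (plus_part A))
     \<and> ((implicative_bilattice (minus_bilattice A) \<and>
          residuated_bilattice_embedding A (minus_bilattice A) (canonical_map A)) \<and>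
         (implicative_bilattice (plus_bilattice A) \<and>
          (\<exists>h. residuated_bilattice_embedding A (plus_bilattice A) h)))
     \<and> (\<forall>(B1 :: 'b bilattice_rec) f.
          implicative_bilattice B1 \<and> residuated_bilattice_hom A B1 f \<longrightarrow>
            (\<exists>!f'. bilattice_extension A B1 f f') \<and>
            (inj_on f (carrier A) \<longrightarrow>
              (\<forall>f'. bilattice_extension A B1 f f' \<longrightarrow>
                 inj_on f' (carrier (minus_bilattice A)))))"
proof -
  interpret residuated_de_morgan_lattice A by fact
  have extension: "(\<exists>!f'. bilattice_extension A B1 f f') \<and>
      (inj_on f (carrier A) \<longrightarrow> (\<forall>f'. bilattice_extension A B1 f f' \<longrightarrow>
        inj_on f' (carrier (minus_bilattice A))))"
    if "implicative_bilattice B1" "residuated_bilattice_hom A B1 f"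
    for B1 :: "'b bilattice_rec" and f
  proof -
    interpret implicative_bilattice B1 by fact
    interpret residuated_bilattice_homomorphism A B1 f
      by unfold_locales (rule that(2))
    show ?thesis
      using bilattice_extension_extension bilattice_extension_unique bilattice_extension_inj
      by blast
  qed
  show ?thesis
    using dually_isomorphic_minus_plus relatively_complemented_minus relatively_complemented_plus
      embedding_minus_bilattice embedding_plus_bilattice extension
      relatively_complemented_lattice.implicative_product_bilattice
        [OF relatively_complemented_lattice_minus]
      relatively_complemented_lattice.implicative_product_bilattice
        [OF relatively_complemented_lattice_dual_plus]
    unfolding minus_bilattice_def plus_bilattice_def by blast
qed

end
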